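(* Let $F$ and $G$ be locally convex Souslin topological vector spaces with Borel $\sigma$-algebras $\mathcal F$ and $\mathcal G$. Let $G$ have a basis $\{f_i\}_{i=1}^\infty$ such that the unique coefficients $y_i$ in $y=\sum_{i=1}^\infty y_if_i$ depend measurably on $y\in G$. Let a $G$-valued random variable $\varepsilon$ be of the form $\varepsilon=\sum_{i=1}^\infty\varepsilon_if_i$, where the random variables $\varepsilon_i$ are statistically independent and have probability density functions $\rho_i$ (with respect to the Lebesgue measure) that are a.e. positive. Let $X$ be an $F$-valued random variable statistically independent from $\varepsilon$, and let $L:F\to G$ be continuous with $L(x)=\sum_{i=1}^\infty L(x)_if_i$ for all $x\in F$. With $L_n(x)=\sum_{i=1}^nL(x)_if_i$, suppose that the densities $$\frac{d\mu_{\varepsilon+L_n(x)}}{d\mu_\varepsilon}(y)=\frac{\prod_{i=1}^n\rho_i(y_i-L(x)_i)}{\prod_{i=1}^n\rho_i(y_i)},\quad n\in\mathbf N,$$ are uniformly integrable with respect to $\mu_\varepsilon$ and convergent $\mu_\varepsilon$-almost everywhere as $n\to\infty$. Then the essentially unique posterior distribution of $X$ given a sample $y$ of $Y=L(X)+\varepsilon$ has a version $\mu(\cdot,y)$ such that $$\mu(U,y)=\frac{\int_U\prod_{i=1}^\infty\frac{\rho_i(y_i-L(x)_i)}{\rho_i(y_i)}\,d\mu_X(x)}{\int_F\prod_{i=1}^\infty\frac{\rho_i(y_i-L(x)_i)}{\rho_i(y_i)}\,d\mu_X(x)},\quad U\in\mathcal F,$$ whenever $0<\int_F\prod_{i=1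}^\infty\frac{\rho_i(y_i-L(x)_i)}{\rho_i(y_i)}\,d\mu_X(x)<\infty$.
   Context: A Souslin space is a Hausdorff topological space that is the image of a complete separable metric space under a continuous mapping. Random variables are defined on a complete probability space $(\Omega,\Sigma,P)$; $\mu_V=P\circ V^{-1}$ denotes the image measure of a random variable $V$; for $x\in F$, $\mu_{\varepsilon+L(x)}$ is the distribution of $\omega\mapsto\varepsilon(\omega)+L(x)$. The series $\sum_i\varepsilon_if_i$ converges almost surely in $G$. A solution of the statistical inverse problem of estimating the distribution of $X$ given $Y$ is a mapping $\mu:\mathcal F\times G\to[0,1]$ such that (1) $\mu(U,Y(\omega))=\mathbf E[1_U(X)|Y^{-1}(\mathcal G)](\omega)$ $P$-a.s. for every $U\in\mathcal F$; (2) $y\mapsto\mu(U,y)$ is $\mu_Y$-measurable (measurable with respect to the $\mu_Y$-completion of $\mathcal G$) for every $U\in\mathcal F$; (3) $\mu(\cdot,y)$ is a probability measure on $(F,\mathcal F)$ for every $y\in G$. The measures $\mu(\cdot,y)$ are the posterior distributions. The posterior distribution is essentially unique if any other solution agrees with it on $\mathcal F\times C$ for some $C$ in the $\mu_Y$-completion of $\mathcal G$ with $\mu_Y(C)=1$; "has a version" means that there is a solution of the displayed form. *)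

theory Defs
  imports "HOL-Probability.Probability"
begin

text \<open>
  The constant \<^const>\<open>convex\<close> is not available inside a class specification over
  \<^class>\<open>real_vector\<close>, so its definition is written out; see \<open>locally_convex\<close> below.
\<close>

class locally_convex_space = real_vector + topological_ab_group_add +
  assumes tendsto_scaleR_Pair:
      "LIM x (nhds c \<times>\<^sub>F nhds a). fst x *\<^sub>R snd x :> nhds (c *\<^sub>R a)"
    and locally_convex_raw:
      "open U \<Longrightarrow> 0 \<in> U \<Longrightarrow>
        \<exists>V. open V \<and> 0 \<in> V \<and> V \<subseteq> U \<and>
          (\<forall>x\<in>V. \<forall>y\<in>V. \<forall>u\<ge>0. \<forall>v\<ge>0. u + v = 1 \<longrightarrow> u *\<^sub>R x + v *\<^sub>R y \<in> V)"

lemma locally_convex: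
  fixes U :: "'a::locally_convex_space set"
  assumes "open U" "0 \<in> U"
  shows "\<exists>V. open V \<and> convex V \<and> 0 \<in> V \<and> V \<subseteq> U"
  using locally_convex_raw[OF assms] unfolding convex_def by blast

text \<open>
  A complete separable metric space has at most continuum many points, so it is no restriction
  to take its points from the type \<^typ>\<open>nat set\<close>; the lemma \<open>souslin_spaceI\<close> below confirms
  this.  The Hausdorff property is contained in the sort constraint.
\<close>

definition souslin_space :: "'a::t2_space itself \<Rightarrow> bool" where
  "souslin_space _ \<longleftrightarrow>
     (\<exists>(m :: nat set metric) (g :: nat set \<Rightarrow> 'a).
        mcomplete_of m \<and> separable_space (mtopology_of m) \<and>
        continuous_map (mtopology_of m) euclidean g \<and> g ` mspace m = UNIV)"

lemma separable_metric_inj_nat_set: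
  fixes m :: "'p metric"
  assumes "separable_space (mtopology_of m)"
  shows "\<exists>e :: 'p \<Rightarrow> nat set. inj_on e (mspace m)"
proof (cases "mspace m = {}")
  case False
  interpret Metric_space "mspace m" "mdist m"
    by (rule Metric_space_mspace_mdist)
  obtain C where C: "countable C" "C \<subseteq> mspace m" "mtopology closure_of C = mspace m"
    using assms by (auto simp: separable_space_def mtopology_of_def)
  define e where
    "e x = {n. mdist m (from_nat_into C (fst (from_nat n :: nat \<times> rat))) x
                 < of_rat (snd (from_nat n :: nat \<times> rat))}" for x
  have "inj_on e (mspace m)"
  proof (rule inj_onI, rule ccontr)
    fix x y assume xy: "x \<in> mspace m" "y \<in> mspace m" "e x = e y" "x \<noteq> y"
    define r where "r = mdist m x y / 2"
    have r: "r > 0" using xy by (simp add: r_def)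
    have "x \<in> mtopology closure_of C" using C(3) xy by simp
    then obtain c where c: "c \<in> C" "mdist m x c < r"
      using r unfolding metric_closure_of by auto
    then have cm: "c \<in> mspace m" using C by auto
    obtain q :: rat where q: "mdist m x c < of_rat q" "of_rat q < r"
      using of_rat_dense[OF c(2)] by blast
    obtain i where i: "from_nat_into C i = c"
      using from_nat_into_surj[OF C(1) c(1)] by blast
    have ee: "to_nat (i, q) \<in> e z \<longleftrightarrow> mdist m c z < of_rat q" for z
      by (simp add: e_def i)
    have "mdist m c y < of_rat q"
      using ee[of x] ee[of y] xy(3) q(1) by (simp add: commute)
    moreover have "mdist m x y \<le> mdist m x c + mdist m c y"
      using triangle[OF xy(1) cm xy(2)] .
    ultimately show False using q by (simp add: r_def)
  qed
  then show ?thesis by blast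
qed auto

lemma souslin_spaceI:
  fixes m :: "'p metric" and g :: "'p \<Rightarrow> 'a::t2_space"
  assumes "mcomplete_of m" "separable_space (mtopology_of m)"
    and "continuous_map (mtopology_of m) euclidean g" "g ` mspace m = UNIV"
  shows "souslin_space TYPE('a)"
proof -
  obtain e :: "'p \<Rightarrow> nat set" where inj: "inj_on e (mspace m)"
    using separable_metric_inj_nat_set[OF assms(2)] by blast
  let ?M = "mspace m" and ?d = "mdist m"
  interpret M: Metric_space ?M ?d
    by (rule Metric_space_mspace_mdist)
  define N where "N = e ` ?M"
  define h where "h = inv_into ?M e"
  define d' where "d' a b = ?d (h a) (h b)" for a b
  have hM: "h a \<in> ?M" if "a \<in> N" for a
    using that unfolding N_def h_def by (rule inv_into_into)
  have eh: "e (h a) = a" if "a \<in> N" for a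
    using that unfolding N_def h_def by (rule f_inv_into_f)
  have he: "h (e x) = x" if "x \<in> ?M" for x
    using that inj unfolding h_def by simp
  have eN: "e x \<in> N" if "x \<in> ?M" for x
    using that by (simp add: N_def)
  interpret N: Metric_space N d'
  proof
    fix x y z
    show "0 \<le> d' x y" "d' x y = d' y x"
      by (simp_all add: d'_def M.commute)
    show "(d' x y = 0) = (x = y)" if "x \<in> N" "y \<in> N"
      using that hM eh by (metis d'_def M.zero)
    show "d' x z \<le> d' x y + d' y z" if "x \<in> N" "y \<in> N" "z \<in> N"
      using that by (simp add: d'_def M.triangle hM)
  qed
  interpret NM: Metric_space12 N d' ?M ?d ..
  have homeo: "homeomorphic_map N.mtopology M.mtopology h"
  proof (rule NM.isometry_imp_homeomorphic_map)
    show "h ` N = ?M"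
      using hM eN he by (auto simp: image_iff) metis
    show "?d (h x) (h y) = d' x y" if "x \<in> N" "y \<in> N" for x y
      by (simp add: d'_def)
  qed
  have mc: "M.mcomplete"
    using assms(1) by (simp add: mcomplete_of_def)
  have "N.mcomplete"
    unfolding N.mcomplete_def
  proof (intro allI impI)
    fix s assume s: "N.MCauchy s"
    have sN: "s n \<in> N" for n using s by (auto simp: N.MCauchy_def)
    have "M.MCauchy (h \<circ> s)"
      using s hM by (auto simp: N.MCauchy_def M.MCauchy_def d'_def)
    then obtain x where x: "limitin M.mtopology (h \<circ> s) x sequentially"
      using mc by (auto simp: M.mcomplete_def)
    then have xM: "x \<in> ?M" by (auto simp: M.limit_metric_sequentially)
    have "limitin N.mtopology s (e x) sequentially"
      using x sN xM eN
      by (simp add: M.limit_metric_sequentially N.limit_metric_sequentially d'_def he) blast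
    then show "\<exists>x. limitin N.mtopology s x sequentially" by blast
  qed
  moreover have "separable_space N.mtopology"
    using homeo assms(2) homeomorphic_separable_space
    by (metis homeomorphic_map_imp_homeomorphic_space mtopology_of_def)
  moreover have "continuous_map N.mtopology euclidean (g \<circ> h)"
    using homeo assms(3)
    by (metis continuous_map_compose homeomorphic_imp_continuous_map mtopology_of_def)
  moreover have "(g \<circ> h) ` N = UNIV"
  proof -
    have "h ` N = ?M"
      using hM eN he by (auto simp: image_iff) metis
    then show ?thesis using assms(4) by (metis image_comp)
  qed
  ultimately show ?thesis
    unfolding souslin_space_def
    by (intro exI[of _ "metric (N, d')"] exI[of _ "g \<circ> h"]) simp
qed

definition schauder_basis :: "(nat \<Rightarrow> 'g::{real_vector, t2_space}) \<Rightarrow> bool" where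
  "schauder_basis f \<longleftrightarrow> (\<forall>y. \<exists>!c :: nat \<Rightarrow> real. (\<lambda>i. c i *\<^sub>R f i) sums y)"

definition coord :: "(nat \<Rightarrow> 'g::{real_vector, t2_space}) \<Rightarrow> 'g \<Rightarrow> nat \<Rightarrow> real" where
  "coord f y = (THE c. (\<lambda>i. c i *\<^sub>R f i) sums y)"

definition uniformly_integrable :: "'a measure \<Rightarrow> 'i set \<Rightarrow> ('i \<Rightarrow> 'a \<Rightarrow> real) \<Rightarrow> bool" where
  "uniformly_integrable M I p \<longleftrightarrow>
     (\<forall>i\<in>I. integrable M (p i)) \<and>
     ((\<lambda>c::real. SUP i\<in>I. \<integral>\<^sup>+ z. ennreal \<bar>p i z\<bar> * indicator {z. \<bar>p i z\<bar> > c} z \<partial>M)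
        \<longlongrightarrow> 0) at_top"

text \<open>
  The library's \<^const>\<open>prob_space.indep_var\<close> only relates random variables with values in the
  same type, hence this variant for two different value types.
\<close>

definition indep_rv ::
  "'w measure \<Rightarrow> ('w \<Rightarrow> 'f::topological_space) \<Rightarrow> ('w \<Rightarrow> 'g::topological_space) \<Rightarrow> bool" where
  "indep_rv M X Z \<longleftrightarrow>
     X \<in> borel_measurable M \<and> Z \<in> borel_measurable M \<and>
     prob_space.indep_set M
       (sets (vimage_algebra (space M) X borel)) (sets (vimage_algebra (space M) Z borel))"

text \<open>
  The infinite product of nonnegative reals, meant as the limit of the partial products in
  \<open>[0,\<infinity>]\<close>.  In contrast to \<^const>\<open>prodinf\<close>, the value \<open>0\<close> is allowed as a limit of nonzero
  partial products.  The limes inferior equals the limit whenever the latter exists, and only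
  fixes a value otherwise.
\<close>

definition infprod :: "(nat \<Rightarrow> real) \<Rightarrow> ennreal" where
  "infprod a = liminf (\<lambda>n. ennreal (\<Prod>i<n. a i))"

text \<open>
  A map \<open>\<mu> : \<F> \<times> G \<rightarrow> [0,1]\<close> that is a probability measure in its first argument is
  represented by the family of measures \<open>y \<mapsto> \<mu>(\<sqdot>, y)\<close>.
\<close>

definition posterior_solution ::
  "'w measure \<Rightarrow> ('w \<Rightarrow> 'f::topological_space) \<Rightarrow> ('w \<Rightarrow> 'g::topological_space)
     \<Rightarrow> ('g \<Rightarrow> 'f measure) \<Rightarrow> bool" where
  "posterior_solution M X Y \<mu> \<longleftrightarrow>
     (\<forall>U\<in>sets borel. AE \<omega> in M. measure (\<mu> (Y \<omega>)) U =
        real_cond_exp M (vimage_algebra (space M) Y borel) (\<lambda>\<omega>. indicator U (X \<omega>)) \<omega>) \<and>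
     (\<forall>U\<in>sets borel. (\<lambda>y. measure (\<mu> y) U) \<in> borel_measurable (completion (distr M borel Y))) \<and>
     (\<forall>y. sets (\<mu> y) = sets borel \<and> prob_space (\<mu> y))"

definition essentially_unique_posterior ::
  "'w measure \<Rightarrow> ('w \<Rightarrow> 'f::topological_space) \<Rightarrow> ('w \<Rightarrow> 'g::topological_space)
     \<Rightarrow> ('g \<Rightarrow> 'f measure) \<Rightarrow> bool" where
  "essentially_unique_posterior M X Y \<mu> \<longleftrightarrow>
     posterior_solution M X Y \<mu> \<and>
     (\<forall>\<mu>'. posterior_solution M X Y \<mu>' \<longrightarrow>
        (\<exists>C\<in>sets (completion (distr M borel Y)).
           measure (completion (distr M borel Y)) C = 1 \<and>
           (\<forall>y\<in>C. \<forall>U\<in>sets borel. measure (\<mu>' y) U = measure (\<mu> y) U)))"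

text \<open>
  The argument \<open>h\<close> plays the role of \<open>L(x)\<close>.  If \<open>\<rho> i (coord f y i) = 0\<close> for some \<open>i\<close>, where the
  quotients have no meaning, then the convention \<open>a / 0 = 0\<close> makes the likelihood of \<open>y\<close> zero.
\<close>

definition shift_density ::
  "(nat \<Rightarrow> 'g::{real_vector, t2_space}) \<Rightarrow> (nat \<Rightarrow> real \<Rightarrow> real) \<Rightarrow> 'g \<Rightarrow> nat \<Rightarrow> 'g \<Rightarrow> real" where
  "shift_density f \<rho> h n y =
     (\<Prod>i<n. \<rho> i (coord f y i - coord f h i)) / (\<Prod>i<n. \<rho> i (coord f y i))"

definition likelihood ::
  "(nat \<Rightarrow> 'g::{real_vector, t2_space}) \<Rightarrow> (nat \<Rightarrow> real \<Rightarrow> real) \<Rightarrow> 'g \<Rightarrow> 'g \<Rightarrow> ennreal" where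
  "likelihood f \<rho> h y =
     infprod (\<lambda>i. \<rho> i (coord f y i - coord f h i) / \<rho> i (coord f y i))"

end

theory Submission
  imports Defs
begin

text \<open>
  The heart of the matter is that the law of \<open>h + \<epsilon>\<close> has density \<open>likelihood f \<rho> h\<close> with respect to
  the law of \<open>\<epsilon>\<close>.  Write \<open>S\<^sub>n\<close> and \<open>h\<^sub>n\<close> for the partial sums of the expansions of \<open>\<epsilon>\<close> and \<open>h\<close>,
  and \<open>q\<^sub>n\<close> for the quotient of the first \<open>n\<close> densities.  By independence, the law of \<open>S\<^sub>n + h\<^sub>n\<close> under
  \<open>P\<close> is the law of \<open>S\<^sub>n\<close> under \<open>q\<^sub>n P\<close>.  By Fatou's lemma, both the law of \<open>h + \<epsilon>\<close> and the measure
  with density \<open>lim q\<^sub>n\<close> give to each open set at most the lower limit of these laws; uniform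
  integrability makes the second measure a probability measure.  As a Souslin topological group is
  regular and hereditarily Lindelof, this forces the two measures to coincide.  Bayes' formula then
  follows from Fubini's theorem.  Essential uniqueness holds because the Borel sets of a Souslin space
  are generated by countably many open sets, which is a consequence of Lusin's separation theorem.
\<close>

section \<open>Countable networks\<close>

text \<open>Members of a network need not be open, unlike those of a base. This weaker notion
  survives continuous images, so it is available for Souslin spaces that are not second
  countable.\<close>

definition countable_network :: "'a::topological_space set set \<Rightarrow> bool" where
  "countable_network \<N> \<longleftrightarrow>
     countable \<N> \<and> (\<forall>U x. open U \<longrightarrow> x \<in> U \<longrightarrow> (\<exists>A\<in>\<N>. x \<in> A \<and> A \<subseteq> U))"

lemma separable_metric_second_countable:
  fixes m :: "'p metric"
  assumes "separable_space (mtopology_of m)"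
  shows "second_countable (mtopology_of m)"
proof -
  interpret Metric_space "mspace m" "mdist m"
    by (rule Metric_space_mspace_mdist)
  obtain C where C: "countable C" "C \<subseteq> mspace m" "mtopology closure_of C = mspace m"
    using assms by (auto simp: separable_space_def mtopology_of_def)
  define \<B> where "\<B> = (\<lambda>(c, n). mball c (inverse (Suc n))) ` (C \<times> (UNIV :: nat set))"
  have "\<exists>V\<in>\<B>. x \<in> V \<and> V \<subseteq> U" if U: "openin mtopology U" "x \<in> U" for U x
  proof -
    obtain r where r: "r > 0" "mball x r \<subseteq> U"
      using U openin_mtopology by blast
    obtain n where n: "inverse (real (Suc n)) < r / 2"
      using reals_Archimedean[of "r / 2"] r by auto
    have x: "x \<in> mspace m"
      using U openin_subset by fastforce
    then have "x \<in> mtopology closure_of C"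
      using C by simp
    moreover have "inverse (real (Suc n)) > 0"
      by simp
    ultimately obtain c where c: "c \<in> C" "c \<in> mball x (inverse (real (Suc n)))"
      unfolding metric_closure_of by blast
    then have "mball c (inverse (Suc n)) \<subseteq> mball x r"
      using n x C by (intro mball_subset) (auto simp: commute)
    moreover have "x \<in> mball c (inverse (Suc n))"
      using c x by (auto simp: commute)
    ultimately show ?thesis
      using c(1) r by (force simp: \<B>_def)
  qed
  moreover have "countable \<B>"
    using C by (simp add: \<B>_def)
  moreover have "\<forall>V\<in>\<B>. openin mtopology V"
    by (auto simp: \<B>_def)
  ultimately show ?thesis
    unfolding second_countable_def mtopology_of_def by (intro exI[of _ \<B>]) simp
qed

text \<open>The images under \<open>g\<close> of a countable base of the metric space form the
  network: the preimage of an open set is open, so it contains a base set around each of its points.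
  The images themselves need not be open.\<close>

lemma souslin_space_countable_network:
  assumes "souslin_space TYPE('a::t2_space)"
  obtains \<N> :: "'a::t2_space set set" where "countable_network \<N>"
proof -
  obtain m :: "nat set metric" and g :: "nat set \<Rightarrow> 'a"
    where m: "separable_space (mtopology_of m)"
      and g: "continuous_map (mtopology_of m) euclidean g" "g ` mspace m = UNIV"
    using assms by (auto simp: souslin_space_def)
  obtain \<B> where \<B>: "countable \<B>"
    "\<And>U x. openin (mtopology_of m) U \<Longrightarrow> x \<in> U \<Longrightarrow> \<exists>V\<in>\<B>. x \<in> V \<and> V \<subseteq> U"
    using separable_metric_second_countable[OF m] unfolding second_countable_def by metis
  have "\<exists>A\<in>(`) g ` \<B>. x \<in> A \<and> A \<subseteq> U" if U: "open U" "x \<in> U" for U x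
  proof -
    obtain p where p: "p \<in> mspace m" "g p = x"
      using g(2) by (metis UNIV_I imageE)
    have "openin (mtopology_of m) {p \<in> mspace m. g p \<in> U}"
      using openin_continuous_map_preimage[OF g(1), of U] U by simp
    then obtain V where V: "V \<in> \<B>" "p \<in> V" "V \<subseteq> {p \<in> mspace m. g p \<in> U}"
      using \<B>(2)[of "{p \<in> mspace m. g p \<in> U}" p] p U by auto
    then have "x \<in> g ` V" "g ` V \<subseteq> U"
      using p by auto
    with V(1) show ?thesis
      by (intro bexI[of _ "g ` V"] conjI imageI)
  qed
  then have "countable_network ((`) g ` \<B>)"
    using \<B>(1) by (auto simp: countable_network_def)
  then show ?thesis
    by (rule that)
qed

text \<open>For each network member that fits into some set of the family, pick one such set. These
  countably many picks already cover the union, since every point of it lies in a network member of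
  this kind. As the family need not cover the space, this is the hereditary Lindelof
  property.\<close>

lemma countable_network_Lindelof:
  fixes \<N> \<U> :: "'a::topological_space set set"
  assumes \<N>: "countable_network \<N>" and "open": "\<And>U. U \<in> \<U> \<Longrightarrow> open U"
  obtains \<V> where "\<V> \<subseteq> \<U>" "countable \<V>" "\<Union>\<V> = \<Union>\<U>"
proof -
  define \<N>' where "\<N>' = {A\<in>\<N>. \<exists>U\<in>\<U>. A \<subseteq> U}"
  have "\<forall>A\<in>\<N>'. \<exists>U. U \<in> \<U> \<and> A \<subseteq> U"
    by (auto simp: \<N>'_def)
  then obtain pick where pick: "\<forall>A\<in>\<N>'. pick A \<in> \<U> \<and> A \<subseteq> pick A"
    by (rule bchoice[THEN exE])
  have "\<Union>\<U> \<subseteq> \<Union>(pick ` \<N>')"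
  proof
    fix x assume "x \<in> \<Union>\<U>"
    then obtain U where U: "U \<in> \<U>" "x \<in> U"
      by auto
    then obtain A where A: "A \<in> \<N>" "x \<in> A" "A \<subseteq> U"
      using \<N> "open"[OF U(1)] unfolding countable_network_def by blast
    then have "A \<in> \<N>'"
      using U by (auto simp: \<N>'_def)
    with A(2) pick show "x \<in> \<Union>(pick ` \<N>')"
      by auto
  qed
  moreover have "pick ` \<N>' \<subseteq> \<U>"
    using pick by auto
  moreover have "countable (pick ` \<N>')"
    using \<N> by (simp add: countable_network_def \<N>'_def)
  ultimately show ?thesis
    using that[of "pick ` \<N>'"] by (simp add: Sup_subset_mono subset_antisym)
qed

lemma countable_network_Times:
  assumes "countable_network \<M>" "countable_network \<N>"
  shows "countable_network {A \<times> B |A B. A \<in> \<M> \<and> B \<in> \<N>}"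
  unfolding countable_network_def
proof (intro conjI allI impI)
  have "{A \<times> B |A B. A \<in> \<M> \<and> B \<in> \<N>} = (\<lambda>p. fst p \<times> snd p) ` (\<M> \<times> \<N>)"
    by force
  then show "countable {A \<times> B |A B. A \<in> \<M> \<and> B \<in> \<N>}"
    using assms by (simp add: countable_network_def)
next
  fix W :: "('a \<times> 'b) set" and z assume "open W" "z \<in> W"
  then obtain U V where UV: "open U" "open V" "z \<in> U \<times> V" "U \<times> V \<subseteq> W"
    by (rule open_prod_elim)
  then have z: "fst z \<in> U" "snd z \<in> V"
    by auto
  obtain A where A: "A \<in> \<M>" "fst z \<in> A" "A \<subseteq> U"
    using assms(1) UV(1) z(1) unfolding countable_network_def by blast
  obtain B where B: "B \<in> \<N>" "snd z \<in> B" "B \<subseteq> V"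
    using assms(2) UV(2) z(2) unfolding countable_network_def by blast
  have "z \<in> A \<times> B" "A \<times> B \<subseteq> W"
    using A B UV(4) by (auto simp: mem_Times_iff)
  moreover have "A \<times> B \<in> {A \<times> B |A B. A \<in> \<M> \<and> B \<in> \<N>}"
    using A(1) B(1) by auto
  ultimately show "\<exists>C\<in>{A \<times> B |A B. A \<in> \<M> \<and> B \<in> \<N>}. z \<in> C \<and> C \<subseteq> W"
    by (intro bexI[of _ "A \<times> B"] conjI)
qed

text \<open>An open set of the product is a union of open rectangles, and the Lindelof property of
  the product makes a countable union suffice. Hence it lies in the product of the Borel
  sigma-algebras, even without second countability. The main application is to addition.\<close>

lemma borel_measurable_continuous_Pair_network:
  fixes h :: "'a::topological_space \<times> 'b::topological_space \<Rightarrow> 'c::topological_space"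
  assumes "countable_network (\<M> :: 'a set set)" "countable_network (\<N> :: 'b set set)"
    and h: "continuous_on UNIV h"
  shows "h \<in> borel_measurable (borel \<Otimes>\<^sub>M borel)"
proof (rule borel_measurableI)
  fix S :: "'c set" assume "open S"
  then have W: "open (h -` S)"
    using h by (simp add: continuous_on_open_vimage)
  define \<U> where "\<U> = {U \<times> V |U V. open U \<and> open V \<and> U \<times> V \<subseteq> h -` S}"
  have "\<Union>\<U> = h -` S"
  proof
    show "h -` S \<subseteq> \<Union>\<U>"
    proof
      fix z assume "z \<in> h -` S"
      then obtain U V where "open U" "open V" "z \<in> U \<times> V" "U \<times> V \<subseteq> h -` S"
        using W by (metis open_prod_elim)
      then show "z \<in> \<Union>\<U>"
        by (auto simp: \<U>_def)
    qed
  qed (auto simp: \<U>_def)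
  moreover have open\<U>: "open W" if "W \<in> \<U>" for W
    using that by (auto simp: \<U>_def open_Times)
  obtain \<V> where \<V>: "\<V> \<subseteq> \<U>" "countable \<V>" "\<Union>\<V> = \<Union>\<U>"
    using countable_network_Lindelof[OF countable_network_Times[OF assms(1,2)] open\<U>] by blast
  moreover have "U \<in> sets (borel \<Otimes>\<^sub>M borel)" if "U \<in> \<V>" for U
    using that \<V>(1) by (auto simp: \<U>_def)
  ultimately show "h -` S \<inter> space (borel \<Otimes>\<^sub>M borel) \<in> sets (borel \<Otimes>\<^sub>M borel)"
    using sets.countable_Union[OF \<V>(2), of "borel \<Otimes>\<^sub>M borel"]
    by (simp add: subset_iff space_pair_measure)
qed

lemma borel_measurable_add_network:
  fixes u v :: "'w \<Rightarrow> 'a::topological_ab_group_add"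
  assumes "countable_network (\<N> :: 'a set set)"
    and "u \<in> borel_measurable M" "v \<in> borel_measurable M"
  shows "(\<lambda>w. u w + v w) \<in> borel_measurable M"
proof -
  have "(\<lambda>z::'a \<times> 'a. fst z + snd z) \<in> borel_measurable (borel \<Otimes>\<^sub>M borel)"
    by (intro borel_measurable_continuous_Pair_network[OF assms(1) assms(1)]
        continuous_on_add continuous_on_fst continuous_on_snd continuous_on_id)
  from measurable_compose[OF measurable_Pair[OF assms(2,3)] this] show ?thesis
    by simp
qed

section \<open>Borel sets of Souslin spaces\<close>

text \<open>Two disjoint members are demanded, not just one member that contains exactly one of the
  points. Lusin's argument below needs neighborhoods of both points at once.\<close>

definition point_separating :: "'a::topological_space set set \<Rightarrow> bool" where
  "point_separating \<S> \<longleftrightarrow>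
     (\<forall>x y. x \<noteq> y \<longrightarrow> (\<exists>U\<in>\<S>. \<exists>V\<in>\<S>. x \<in> U \<and> y \<in> V \<and> U \<inter> V = {}))"

text \<open>By the Hausdorff property the complement of the diagonal is the union of the rectangles
  \<open>U \<times> V\<close> with \<open>U\<close>, \<open>V\<close> open and disjoint. Countably
  many of them suffice by the Lindelof property, and their sides form the required family.\<close>

lemma countable_network_point_separating:
  assumes "countable_network (\<N> :: 'a::t2_space set set)"
  obtains \<S> :: "'a::t2_space set set"
  where "countable \<S>" "\<And>U. U \<in> \<S> \<Longrightarrow> open U" "point_separating \<S>"
proof -
  define \<P> where "\<P> = {(U, V) |U V :: 'a set. open U \<and> open V \<and> U \<inter> V = {}}"
  define rect where "rect = (\<lambda>(U, V). U \<times> V :: ('a \<times> 'a) set)"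
  have "open W" if "W \<in> rect ` \<P>" for W
    using that by (auto simp: \<P>_def rect_def open_Times)
  then obtain \<V> where \<V>: "\<V> \<subseteq> rect ` \<P>" "countable \<V>" "\<Union>\<V> = \<Union>(rect ` \<P>)"
    using countable_network_Lindelof[OF countable_network_Times[OF assms assms]] by metis
  \<comment> \<open>An empty rectangle does not determine its sides, so a countable set of pairs is
    chosen that induces the selected rectangles.\<close>
  then obtain \<Q> where \<Q>: "\<Q> \<subseteq> \<P>" "countable \<Q>" "\<V> = rect ` \<Q>"
    using countable_subset_image[of \<V> rect \<P>] by auto
  have disj: "open (fst q)" "open (snd q)" "fst q \<inter> snd q = {}" if "q \<in> \<Q>" for q
    using subsetD[OF \<Q>(1) that] unfolding \<P>_def by auto
  define \<S> where "\<S> = fst ` \<Q> \<union> snd ` \<Q>"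
  have "countable \<S>"
    using \<Q> by (simp add: \<S>_def)
  moreover have "\<forall>U\<in>\<S>. open U"
    using disj(1,2) by (simp add: \<S>_def ball_Un)
  moreover have "point_separating \<S>"
    unfolding point_separating_def
  proof (intro allI impI)
    fix x y :: 'a assume xy: "x \<noteq> y"
    obtain U V where "open U" "open V" "x \<in> U" "y \<in> V" "U \<inter> V = {}"
      using hausdorff[OF xy] by (elim exE conjE)
    then have "(U, V) \<in> \<P>" "(x, y) \<in> rect (U, V)"
      by (auto simp: \<P>_def rect_def)
    then obtain q where q: "q \<in> \<Q>" "(x, y) \<in> rect q"
      using \<V>(3) \<Q>(3) by blast
    then have "x \<in> fst q" "y \<in> snd q" "fst q \<inter> snd q = {}"
      using disj(3) by (simp_all add: rect_def case_prod_beta)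
    with q(1) show "\<exists>U\<in>\<S>. \<exists>V\<in>\<S>. x \<in> U \<and> y \<in> V \<and> U \<inter> V = {}"
      unfolding \<S>_def by (intro bexI[of _ "fst q"] bexI[of _ "snd q"]) auto
  qed
  ultimately show ?thesis
    using that[of \<S>] by simp
qed

text \<open>Asymmetric in form, but symmetric as soon as \<open>\<A>\<close> is closed under
  complements.\<close>

definition separated_by :: "'a set set \<Rightarrow> 'a set \<Rightarrow> 'a set \<Rightarrow> bool" where
  "separated_by \<A> A B \<longleftrightarrow> (\<exists>S\<in>\<A>. A \<subseteq> S \<and> S \<inter> B = {})"

text \<open>If \<open>S i j\<close> separates \<open>A i\<close> from \<open>B j\<close>, then the
  union over \<open>i\<close> of the intersections over \<open>j\<close> of \<open>S i j\<close>
  separates the unions; the intersections are written as complements of unions. Read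
  contrapositively, inseparable unions contain an inseparable pair of pieces.\<close>

lemma separated_by_countable_Union:
  assumes "sigma_algebra UNIV \<A>" "countable I" "countable J"
    and sep: "\<And>i j. i \<in> I \<Longrightarrow> j \<in> J \<Longrightarrow> separated_by \<A> (A i) (B j)"
  shows "separated_by \<A> (\<Union>i\<in>I. A i) (\<Union>j\<in>J. B j)"
proof -
  interpret sigma_algebra UNIV \<A> by fact
  obtain S where S: "\<And>i j. i \<in> I \<Longrightarrow> j \<in> J \<Longrightarrow> S i j \<in> \<A> \<and> A i \<subseteq> S i j \<and> S i j \<inter> B j = {}"
    using sep unfolding separated_by_def by metis
  have "(\<Union>i\<in>I. UNIV - (\<Union>j\<in>J. UNIV - S i j)) \<in> \<A>"
    using S assms(2,3) by (intro countable_UN'' compl_sets) auto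
  moreover have "(\<Union>i\<in>I. A i) \<subseteq> (\<Union>i\<in>I. UNIV - (\<Union>j\<in>J. UNIV - S i j))"
    using S by blast
  moreover have "(\<Union>i\<in>I. UNIV - (\<Union>j\<in>J. UNIV - S i j)) \<inter> (\<Union>j\<in>J. B j) = {}"
    using S by blast
  ultimately show ?thesis
    unfolding separated_by_def by blast
qed

text \<open>
  If the images of two closed sets cannot be separated, then neither can the images of some pair of
  closed pieces of small diameter.  Iterating gives nested pairs that shrink to two points with
  distinct images, and members of \<open>\<S>\<close> that separate these two images separate a late pair.
\<close>

lemma Lusin_separation_closed:
  fixes m :: "'p metric" and g :: "'p \<Rightarrow> 'a::topological_space"
  assumes complete: "mcomplete_of m" and separable: "separable_space (mtopology_of m)"
    and g: "continuous_map (mtopology_of m) euclidean g"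
    and \<S>: "\<And>U. U \<in> \<S> \<Longrightarrow> open U" "point_separating \<S>"
    and KC: "closedin (mtopology_of m) K" "closedin (mtopology_of m) C" "g ` K \<inter> g ` C = {}"
  shows "separated_by (sigma_sets UNIV \<S>) (g ` K) (g ` C)"
proof (rule ccontr)
  assume not_sep: "\<not> separated_by (sigma_sets UNIV \<S>) (g ` K) (g ` C)"
  interpret Metric_space "mspace m" "mdist m"
    by (rule Metric_space_mspace_mdist)
  have mtop [simp]: "mtopology_of m = mtopology"
    by (simp add: mtopology_of_def)
  have sa: "sigma_algebra UNIV (sigma_sets UNIV \<S>)"
    by (simp add: sigma_algebra_sigma_sets)
  define bad where "bad p \<longleftrightarrow> closedin mtopology (fst p) \<and> closedin mtopology (snd p) \<and>
    \<not> separated_by (sigma_sets UNIV \<S>) (g ` fst p) (g ` snd p)" for p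
  define small where "small r A \<longleftrightarrow> (\<exists>a. A \<subseteq> mcball a r)" for r and A :: "'p set"
  obtain D where D: "countable D" "D \<subseteq> mspace m" "mtopology closure_of D = mspace m"
    using separable by (auto simp: separable_space_def)
  have cover: "A = (\<Union>d\<in>D. A \<inter> mcball d r)" if "closedin mtopology A" "r > 0" for A r
  proof
    show "A \<subseteq> (\<Union>d\<in>D. A \<inter> mcball d r)"
    proof
      fix x assume "x \<in> A"
      then have "x \<in> mtopology closure_of D"
        using that closedin_subset D by fastforce
      then obtain d where "d \<in> D" "d \<in> mball x r"
        using \<open>r > 0\<close> unfolding metric_closure_of by blast
      then show "x \<in> (\<Union>d\<in>D. A \<inter> mcball d r)"
        using \<open>x \<in> A\<close> by (auto simp: commute intro!: bexI[of _ d])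
    qed
  qed auto
  \<comment> \<open>Closed balls of radius \<open>r\<close> around a countable dense set cut both
    members of the pair into countably many closed pieces. If each pair of pieces had separable
    images, so would the whole pair.\<close>
  have step: "\<exists>q. bad q \<and> fst q \<subseteq> fst p \<and> snd q \<subseteq> snd p \<and> small r (fst q) \<and> small r (snd q)"
    if p: "bad p" and r: "r > 0" for p r
  proof (rule ccontr)
    assume contra: "\<not> ?thesis"
    have "separated_by (sigma_sets UNIV \<S>)
        (\<Union>d\<in>D. g ` (fst p \<inter> mcball d r)) (\<Union>d\<in>D. g ` (snd p \<inter> mcball d r))"
    proof (rule separated_by_countable_Union[OF sa D(1) D(1)], rule ccontr)
      fix i j assume "i \<in> D" "j \<in> D" and
        "\<not> separated_by (sigma_sets UNIV \<S>) (g ` (fst p \<inter> mcball i r)) (g ` (snd p \<inter> mcball j r))"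
      then have "bad (fst p \<inter> mcball i r, snd p \<inter> mcball j r)"
        using p by (auto simp: bad_def)
      moreover have "small r (fst p \<inter> mcball i r)" "small r (snd p \<inter> mcball j r)"
        by (auto simp: small_def)
      ultimately show False
        using contra by (metis Int_lower1 fst_conv snd_conv)
    qed
    moreover have "(\<Union>d\<in>D. g ` (fst p \<inter> mcball d r)) = g ` fst p"
      "(\<Union>d\<in>D. g ` (snd p \<inter> mcball d r)) = g ` snd p"
      using cover[of "fst p" r] cover[of "snd p" r] p r
      unfolding image_UN[symmetric] bad_def by auto
    ultimately show False
      using p by (simp add: bad_def)
  qed
  obtain s where s: "\<And>n. bad (s n)" "\<And>n. fst (s (Suc n)) \<subseteq> fst (s n)"
    "\<And>n. snd (s (Suc n)) \<subseteq> snd (s n)" "s 0 = (K, C)"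
    and s_small: "\<And>n. small (inverse (Suc n)) (fst (s (Suc n)))"
      "\<And>n. small (inverse (Suc n)) (snd (s (Suc n)))"
  proof -
    define R where "R n p q \<longleftrightarrow> fst q \<subseteq> fst p \<and> snd q \<subseteq> snd p \<and>
      small (inverse (Suc n)) (fst q) \<and> small (inverse (Suc n)) (snd q)"
      for n :: nat and p q :: "'p set \<times> 'p set"
    \<comment> \<open>The conjunct for \<open>n = 0\<close> forces the dependent choice to start at
      \<open>(K, C)\<close>.\<close>
    have "\<exists>s. \<forall>n. (bad (s n) \<and> (n = 0 \<longrightarrow> s n = (K, C))) \<and> R n (s n) (s (Suc n))"
    proof (rule dependent_nat_choice)
      show "\<exists>p. bad p \<and> (0 = (0::nat) \<longrightarrow> p = (K, C))"
        using not_sep KC by (simp add: bad_def)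
      show "\<exists>q. (bad q \<and> (Suc n = 0 \<longrightarrow> q = (K, C))) \<and> R n p q"
        if "bad p \<and> (n = 0 \<longrightarrow> p = (K, C))" for p n
        using step[of p "inverse (Suc n)"] that by (auto simp: R_def)
    qed
    then show thesis
      unfolding R_def by (metis that)
  qed
  \<comment> \<open>Completeness yields a common point of the nested closed sets by Cantor's
    theorem. Continuity of \<open>g\<close> at this point then puts the images of late sets into any
    given neighborhood of its image.\<close>
  have limit: "\<exists>x\<in>mspace m. (\<forall>n. x \<in> T n) \<and> (\<forall>U. open U \<longrightarrow> g x \<in> U \<longrightarrow> (\<exists>n. g ` T n \<subseteq> U))"
    if T: "\<And>n. closedin mtopology (T n)" "\<And>n. T n \<noteq> {}" "\<And>n. T (Suc n) \<subseteq> T n"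
      and Ts: "\<And>n. small (inverse (Suc n)) (T (Suc n))" for T
  proof -
    have fine: "\<exists>n a. T n \<subseteq> mcball a r" if r: "r > 0" for r
    proof -
      obtain n where n: "inverse (real (Suc n)) < r"
        using reals_Archimedean r by blast
      with Ts[of n] show ?thesis
        using mcball_subset_concentric[of "inverse (real (Suc n))" r] unfolding small_def
        by (meson less_imp_le subset_trans)
    qed
    have mc: mcomplete
      using complete by (simp add: mcomplete_of_def)
    have "\<Inter>(range T) \<noteq> {}"
      using mc T fine decseq_SucI[of T] unfolding mcomplete_nest by blast
    then obtain x where x: "\<And>n. x \<in> T n"
      by auto
    have xm: "x \<in> mspace m"
      using x[of 0] T(1)[of 0] closedin_subset by fastforce
    have "\<exists>n. g ` T n \<subseteq> U" if U: "open U" "g x \<in> U" for U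
    proof -
      have "openin mtopology {p \<in> mspace m. g p \<in> U}"
        using openin_continuous_map_preimage[OF g, of U] U by simp
      then obtain r where r: "r > 0" "mball x r \<subseteq> {p \<in> mspace m. g p \<in> U}"
        using U xm unfolding openin_mtopology by blast
      \<comment> \<open>Two points of a closed ball of radius \<open>r / 3\<close> have distance at
        most \<open>2 * r / 3\<close>, which is less than \<open>r\<close>.\<close>
      obtain n a where na: "T n \<subseteq> mcball a (r / 3)"
        using fine[of "r / 3"] r by auto
      have "T n \<subseteq> mball x r"
      proof
        fix y assume "y \<in> T n"
        then have "mdist m a y \<le> r / 3" "mdist m a x \<le> r / 3" "a \<in> mspace m" "y \<in> mspace m"
          using na x[of n] by auto
        moreover have "mdist m x y \<le> mdist m x a + mdist m a y"
          using calculation xm triangle by blast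
        ultimately show "y \<in> mball x r"
          using xm r(1) by (simp add: commute)
      qed
      with r show ?thesis
        by blast
    qed
    with x xm show ?thesis
      by blast
  qed
  \<comment> \<open>The empty set is separated from every set, so both members of an inseparable
    pair are nonempty, as Cantor's theorem requires.\<close>
  have triv: "separated_by (sigma_sets UNIV \<S>) {} B" "separated_by (sigma_sets UNIV \<S>) B {}" for B
    unfolding separated_by_def using sigma_sets.Empty sigma_sets_top by blast+
  have ne: "fst (s n) \<noteq> {}" "snd (s n) \<noteq> {}" for n
    using s(1)[of n] triv by (auto simp: bad_def)
  obtain x where x: "\<And>n. x \<in> fst (s n)" "\<And>U. open U \<Longrightarrow> g x \<in> U \<Longrightarrow> \<exists>n. g ` fst (s n) \<subseteq> U"
    using limit[of "\<lambda>n. fst (s n)"] s ne s_small by (auto simp: bad_def)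
  obtain y where y: "\<And>n. y \<in> snd (s n)" "\<And>U. open U \<Longrightarrow> g y \<in> U \<Longrightarrow> \<exists>n. g ` snd (s n) \<subseteq> U"
    using limit[of "\<lambda>n. snd (s n)"] s ne s_small by (auto simp: bad_def)
  have "g x \<noteq> g y"
    using x(1)[of 0] y(1)[of 0] s(4) KC(3) by auto
  then obtain U V where UV: "U \<in> \<S>" "V \<in> \<S>" "g x \<in> U" "g y \<in> V" "U \<inter> V = {}"
    using \<S>(2) unfolding point_separating_def by blast
  obtain k l where kl: "g ` fst (s k) \<subseteq> U" "g ` snd (s l) \<subseteq> V"
    using x(2)[of U] y(2)[of V] UV \<S>(1) by auto
  \<comment> \<open>The two images enter \<open>U\<close> and \<open>V\<close> at possibly different
    indices; the later index serves for both.\<close>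
  have "fst (s (max k l)) \<subseteq> fst (s k)" "snd (s (max k l)) \<subseteq> snd (s l)"
    using lift_Suc_antimono_le[of "\<lambda>n. fst (s n)" k "max k l"]
      lift_Suc_antimono_le[of "\<lambda>n. snd (s n)" l "max k l"] s(2,3) by auto
  with kl UV have "g ` fst (s (max k l)) \<subseteq> U \<and> U \<inter> g ` snd (s (max k l)) = {}"
    by blast
  then have "separated_by (sigma_sets UNIV \<S>) (g ` fst (s (max k l))) (g ` snd (s (max k l)))"
    unfolding separated_by_def using UV(1) by blast
  with s(1) show False
    by (simp add: bad_def)
qed

text \<open>The preimage \<open>W\<close> of an open set \<open>U\<close> is a countable union of
  closed sets of the metric space, and its complement is closed. Lusin separation therefore yields a
  set generated by \<open>\<S>\<close> that separates \<open>U\<close> from its complement, and the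
  only such set is \<open>U\<close> itself.\<close>

lemma souslin_borel_eq_sigma_sets:
  assumes "souslin_space TYPE('a::t2_space)"
    and \<S>: "\<And>U. U \<in> \<S> \<Longrightarrow> open U" "point_separating (\<S> :: 'a::t2_space set set)"
  shows "sets borel = sigma_sets UNIV \<S>"
proof
  obtain m :: "nat set metric" and g :: "nat set \<Rightarrow> 'a"
    where m: "mcomplete_of m" "separable_space (mtopology_of m)"
      and g: "continuous_map (mtopology_of m) euclidean g" "g ` mspace m = UNIV"
    using assms by (auto simp: souslin_space_def)
  interpret Metric_space "mspace m" "mdist m"
    by (rule Metric_space_mspace_mdist)
  have mtop: "mtopology_of m = mtopology"
    by (simp add: mtopology_of_def)
  interpret sa: sigma_algebra UNIV "sigma_sets UNIV \<S>"
    by (simp add: sigma_algebra_sigma_sets)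
  have "\<S> \<subseteq> sets borel"
    using \<S>(1) by auto
  then show "sigma_sets UNIV \<S> \<subseteq> sets borel"
    using sets.sigma_sets_subset[of \<S> borel] by simp
  have "U \<in> sigma_sets UNIV \<S>" if "open U" for U
  proof -
    define W where "W = {p \<in> mspace m. g p \<in> U}"
    have W: "openin mtopology W"
      using openin_continuous_map_preimage[OF g(1), of U] that by (simp add: W_def mtop)
    have "fsigma_in mtopology W"
      using W metrizable_space_mtopology open_imp_fsigma_in by blast
    then obtain K where K: "\<And>n::nat. closedin mtopology (K n)" "(\<Union>n. K n) = W"
      unfolding fsigma_in_ascending by auto
    have C: "closedin mtopology (mspace m - W)"
      using W by (simp add: openin_closedin_eq)
    have KO: "K n \<subseteq> W" for n
      using K(2) by auto
    \<comment> \<open>The index set \<open>{()}\<close> presents the image of the closed complement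
      as a union with a single member.\<close>
    have "separated_by (sigma_sets UNIV \<S>) (\<Union>n\<in>UNIV. g ` K n) (\<Union>i\<in>{()}. g ` (mspace m - W))"
    proof (rule separated_by_countable_Union[OF sa.sigma_algebra_axioms])
      show "separated_by (sigma_sets UNIV \<S>) (g ` K n) (g ` (mspace m - W))" for n
      proof (rule Lusin_separation_closed[OF m g(1) \<S>])
        have "g ` K n \<subseteq> U" "g ` (mspace m - W) \<subseteq> - U"
          using KO[of n] by (auto simp: W_def)
        then show "g ` K n \<inter> g ` (mspace m - W) = {}"
          by blast
      qed (use K(1) C mtop in auto)
    qed auto
    moreover have "(\<Union>n\<in>UNIV. g ` K n) = U"
    proof -
      have "(\<Union>n\<in>UNIV. g ` K n) = g ` W"
        using K(2) by auto
      also have "\<dots> = U"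
        using g(2) by (auto simp: W_def)
      finally show ?thesis .
    qed
    moreover have "g ` (mspace m - W) = - U"
    proof
      show "- U \<subseteq> g ` (mspace m - W)"
      proof
        fix x assume "x \<in> - U"
        moreover obtain p where "p \<in> mspace m" "g p = x"
          using g(2) by (metis UNIV_I imageE)
        ultimately show "x \<in> g ` (mspace m - W)"
          by (auto simp: W_def)
      qed
    qed (auto simp: W_def)
    ultimately obtain S where "S \<in> sigma_sets UNIV \<S>" "U \<subseteq> S" "S \<inter> - U = {}"
      by (auto simp: separated_by_def)
    moreover from this have "S = U"
      by blast
    ultimately show ?thesis
      by simp
  qed
  then show "sets borel \<subseteq> sigma_sets UNIV \<S>"
    unfolding borel_def using sa.sigma_sets_subset[of "Collect open"] by auto
qed

section \<open>Uniqueness of weak limits\<close>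

text \<open>Regularity of topological groups. The map sending \<open>(a, b)\<close> to
  \<open>x + a - b\<close> is continuous at \<open>(0, 0)\<close>, which gives neighborhoods
  \<open>A\<close>, \<open>B\<close> of \<open>0\<close>; take \<open>V\<close> to be the translate
  of \<open>A\<close> by \<open>x\<close>. If \<open>y\<close> is in the closure of
  \<open>V\<close>, then the translate of \<open>B\<close> by \<open>y\<close> meets
  \<open>V\<close> in some \<open>z\<close>, and \<open>y = x + (z - x) - (z - y)\<close> lies in
  \<open>W\<close>.\<close>

lemma topological_group_closure_subset:
  fixes W :: "'a::topological_ab_group_add set"
  assumes "open W" "x \<in> W"
  obtains V where "open V" "x \<in> V" "closure V \<subseteq> W"
proof -
  have "continuous_on UNIV (\<lambda>z::'a \<times> 'a. x + fst z - snd z)"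
    by (intro continuous_intros)
  then have "open ((\<lambda>z::'a \<times> 'a. x + fst z - snd z) -` W)"
    using assms(1) by (simp add: continuous_on_open_vimage)
  moreover have "(0, 0) \<in> (\<lambda>z::'a \<times> 'a. x + fst z - snd z) -` W"
    using assms(2) by simp
  ultimately obtain A B where AB: "open A" "open B" "(0, 0) \<in> A \<times> B"
    "A \<times> B \<subseteq> (\<lambda>z::'a \<times> 'a. x + fst z - snd z) -` W"
    by (rule open_prod_elim)
  have shift: "open ((\<lambda>z. z - y) -` C)" if C: "open C" for y :: 'a and C
  proof -
    have "continuous_on UNIV (\<lambda>z::'a. z - y)"
      by (intro continuous_intros)
    with C show ?thesis
      by (simp add: continuous_on_open_vimage)
  qed
  have "y \<in> W" if y: "y \<in> closure ((\<lambda>z. z - x) -` A)" for y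
  proof -
    have "y \<in> (\<lambda>z. z - y) -` B"
      using AB(3) by simp
    then have "(\<lambda>z. z - y) -` B \<inter> closure ((\<lambda>z. z - x) -` A) \<noteq> {}"
      using y by blast
    then obtain z where z: "z - y \<in> B" "z - x \<in> A"
      using open_Int_closure_eq_empty[OF shift[OF AB(2)]] by blast
    then have "x + (z - x) - (z - y) \<in> W"
      using AB(4) by auto
    then show ?thesis
      by simp
  qed
  then show ?thesis
    using that[of "(\<lambda>z. z - x) -` A"] shift[OF AB(1)] AB(3) by auto
qed

text \<open>
  Two weak limits of one sequence of probability measures satisfy the hypothesis below; hence this
  gives uniqueness of weak limits without any continuous functions.
\<close>

lemma prob_eqI_disjoint_open:
  fixes \<mu> \<nu> :: "'a::topological_ab_group_add measure"
  assumes net: "countable_network (\<N> :: 'a set set)"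
    and "prob_space \<mu>" "prob_space \<nu>" and sets: "sets \<mu> = sets borel" "sets \<nu> = sets borel"
    and disj: "\<And>U V. open U \<Longrightarrow> open V \<Longrightarrow> U \<inter> V = {} \<Longrightarrow> emeasure \<mu> U + emeasure \<nu> V \<le> 1"
  shows "\<mu> = \<nu>"
proof -
  \<comment> \<open>The hypothesis on disjoint open sets is symmetric in the two measures. The
    inequality is therefore proved for arbitrary measures and then used in both directions.\<close>
  have le: "emeasure \<mu> W \<le> emeasure \<nu> W"
    if \<mu>: "prob_space \<mu>" "sets \<mu> = sets borel" and \<nu>: "prob_space \<nu>" "sets \<nu> = sets borel"
      and disj: "\<And>U V. open U \<Longrightarrow> open V \<Longrightarrow> U \<inter> V = {} \<Longrightarrow> emeasure \<mu> U + emeasure \<nu> V \<le> 1"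
      and W: "open W" for \<mu> \<nu> :: "'a measure" and W
  proof -
    interpret \<mu>: prob_space \<mu> by fact
    interpret \<nu>: prob_space \<nu> by fact
    have space: "space \<mu> = UNIV" "space \<nu> = UNIV"
      using sets_eq_imp_space_eq[OF \<mu>(2)] sets_eq_imp_space_eq[OF \<nu>(2)] by auto
    have closure_le: "emeasure \<mu> V \<le> emeasure \<nu> (closure V)" if V: "open V" for V
    proof -
      \<comment> \<open>The complement of the closure is the largest open set disjoint from
        \<open>V\<close>.\<close>
      have "emeasure \<mu> V + emeasure \<nu> (- closure V) \<le> 1"
        using V closure_subset[of V] by (intro disj) auto
      moreover have "\<nu>.prob (- closure V) = 1 - \<nu>.prob (closure V)"
        using \<nu>.prob_compl[of "closure V"] \<nu>(2) space by (simp add: Compl_eq_Diff_UNIV)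
      ultimately show ?thesis
        by (simp add: \<mu>.emeasure_eq_measure \<nu>.emeasure_eq_measure flip: ennreal_plus)
    qed
    define \<U> where "\<U> = {V. open V \<and> closure V \<subseteq> W}"
    have "W \<subseteq> \<Union>\<U>"
    proof
      fix x assume "x \<in> W"
      then obtain V where "open V" "x \<in> V" "closure V \<subseteq> W"
        using topological_group_closure_subset[OF W] by metis
      then show "x \<in> \<Union>\<U>"
        by (auto simp: \<U>_def)
    qed
    moreover have "\<Union>\<U> \<subseteq> W"
      using closure_subset by (fastforce simp: \<U>_def)
    moreover obtain \<V> where \<V>: "\<V> \<subseteq> \<U>" "countable \<V>" "\<Union>\<V> = \<Union>\<U>"
      using countable_network_Lindelof[OF net, of \<U>] by (auto simp: \<U>_def)
    ultimately have \<V>_W: "\<Union>\<V> = W"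
      by simp
    show ?thesis
    proof (cases "\<V> = {}")
      case False
      \<comment> \<open>Regularity exhausts \<open>W\<close> by open sets whose closures stay in
        \<open>W\<close>, and countably many suffice. A finite union of closures is closed, so the
        sets \<open>T n\<close> also have closures in \<open>W\<close>; they increase to
        \<open>W\<close>, and continuity from below finishes.\<close>
      define T where "T n = (\<Union>i\<le>n. from_nat_into \<V> i)" for n
      have fin: "from_nat_into \<V> i \<in> \<U>" for i
        using from_nat_into[OF False] \<V>(1) by blast
      have "(\<Union>n. T n) = (\<Union>i. from_nat_into \<V> i)"
        by (auto simp: T_def)
      also have "\<dots> = W"
        using range_from_nat_into[OF False \<V>(2)] \<V>_W by simp
      finally have T_W: "(\<Union>n. T n) = W" .
      have T_open: "open (T n)" for n
        using fin by (auto simp: T_def \<U>_def)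
      have "closure (T n) \<subseteq> W" for n
      proof -
        have "closed (\<Union>i\<le>n. closure (from_nat_into \<V> i))"
          by (intro closed_UN) auto
        moreover have "T n \<subseteq> (\<Union>i\<le>n. closure (from_nat_into \<V> i))"
          using closure_subset by (fastforce simp: T_def)
        ultimately have "closure (T n) \<subseteq> (\<Union>i\<le>n. closure (from_nat_into \<V> i))"
          by (rule closure_minimal[rotated])
        then show ?thesis
          using fin by (auto simp: \<U>_def)
      qed
      then have "emeasure \<nu> (closure (T n)) \<le> emeasure \<nu> W" for n
        using W \<nu>(2) by (intro emeasure_mono) auto
      then have "emeasure \<mu> (T n) \<le> emeasure \<nu> W" for n
        using closure_le[OF T_open[of n]] order_trans by blast
      then have "(SUP n. emeasure \<mu> (T n)) \<le> emeasure \<nu> W"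
        by (intro SUP_least) auto
      moreover have "incseq T"
        unfolding T_def by (intro monoI UN_mono) auto
      then have "(SUP n. emeasure \<mu> (T n)) = emeasure \<mu> W"
        using SUP_emeasure_incseq[of T \<mu>] T_open \<mu>(2) T_W by (auto simp: image_subset_iff)
      ultimately show ?thesis
        by simp
    qed (use \<V>_W in auto)
  qed
  have "emeasure \<mu> W = emeasure \<nu> W" if W: "open W" for W
  proof (rule antisym)
    show "emeasure \<mu> W \<le> emeasure \<nu> W"
      by (rule le[OF assms(2) sets(1) assms(3) sets(2) disj W])
    show "emeasure \<nu> W \<le> emeasure \<mu> W"
      by (rule le[OF assms(3) sets(2) assms(2) sets(1) _ W])
        (use disj in \<open>auto simp: add.commute Int_commute\<close>)
  qed
  then show ?thesis
  proof (intro measure_eqI_generator_eq[of "Collect open" UNIV \<mu> \<nu> "\<lambda>_. UNIV"])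
    show "Int_stable (Collect (open :: 'a set \<Rightarrow> bool))"
      by (auto simp: Int_stable_def)
    show "sets \<mu> = sigma_sets UNIV (Collect open)" "sets \<nu> = sigma_sets UNIV (Collect open)"
      using sets by (simp_all add: borel_def)
    show "emeasure \<mu> UNIV \<noteq> \<infinity>"
      using finite_measure.emeasure_finite[of \<mu> UNIV] assms(2) by (simp add: prob_space_def)
  qed auto
qed

section \<open>Lower limits and uniform integrability\<close>

lemma ennreal_liminf_add_le:
  fixes a b :: "nat \<Rightarrow> ennreal"
  assumes "\<And>n. a n + b n \<le> c"
  shows "liminf a + liminf b \<le> c"
proof -
  have mono: "incseq (\<lambda>n. INF m\<in>{n..}. u m)" for u :: "nat \<Rightarrow> ennreal"
    by (intro monoI INF_superset_mono) auto
  have "liminf a + liminf b = (SUP n. (INF m\<in>{n..}. a m) + (INF m\<in>{n..}. b m))"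
    unfolding liminf_SUP_INF by (rule ennreal_SUP_add[OF mono mono, symmetric])
  also have "\<dots> \<le> c"
  proof (rule SUP_least)
    fix n
    have "(INF m\<in>{n..}. a m) + (INF m\<in>{n..}. b m) \<le> a n + b n"
      by (intro add_mono INF_lower) auto
    also note assms
    finally show "(INF m\<in>{n..}. a m) + (INF m\<in>{n..}. b m) \<le> c" .
  qed
  finally show ?thesis .
qed

text \<open>Truncate at \<open>c\<close>. The truncated functions converge under the integral by
  domination, and the excess is bounded uniformly in \<open>n\<close> by \<open>tail c\<close>,
  which vanishes as \<open>c\<close> tends to infinity. So no mass is lost in the limit.\<close>

lemma uniformly_integrable_nn_integral_liminf_ge_1:
  fixes q :: "nat \<Rightarrow> 'a \<Rightarrow> real"
  assumes "prob_space N" and ui: "uniformly_integrable N {1..} q"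
    and conv: "AE z in N. convergent (\<lambda>n. q n z)"
    and nonneg: "\<And>n z. 0 \<le> q n z" and one: "\<And>n. (\<integral>\<^sup>+ z. ennreal (q n z) \<partial>N) = 1"
  shows "1 \<le> (\<integral>\<^sup>+ z. liminf (\<lambda>n. ennreal (q n z)) \<partial>N)" (is "1 \<le> ?I")
proof -
  interpret prob_space N by fact
  \<comment> \<open>Uniform integrability speaks only of indices from \<open>1\<close> on, hence the
    successor here and in the limits below.\<close>
  have [measurable]: "q (Suc n) \<in> borel_measurable N" for n
    using ui by (auto simp: uniformly_integrable_def)
  define tail where
    "tail c = (SUP i\<in>{1..}. \<integral>\<^sup>+ z. ennreal \<bar>q i z\<bar> * indicator {z. \<bar>q i z\<bar> > c} z \<partial>N)" for c
  have tail: "(tail \<longlongrightarrow> 0) at_top"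
    using ui by (simp add: uniformly_integrable_def tail_def[abs_def])
  have bound: "1 \<le> ?I + tail c" if "c > 0" for c
  proof -
    have lim: "(\<lambda>n. \<integral>\<^sup>+ z. ennreal (min (q (Suc n) z) c) \<partial>N)
      \<longlonglongrightarrow> (\<integral>\<^sup>+ z. ennreal (min (lim (\<lambda>n. q (Suc n) z)) c) \<partial>N)"
    proof (rule nn_integral_dominated_convergence[where w = "\<lambda>_. ennreal c"])
      show "AE z in N. (\<lambda>n. ennreal (min (q (Suc n) z) c))
          \<longlonglongrightarrow> ennreal (min (lim (\<lambda>n. q (Suc n) z)) c)"
        using conv
      proof eventually_elim
        case (elim z)
        then have "convergent (\<lambda>n. q (Suc n) z)"
          using convergent_Suc_iff[of "\<lambda>n. q n z"] by simp
        then have "(\<lambda>n. q (Suc n) z) \<longlonglongrightarrow> lim (\<lambda>n. q (Suc n) z)"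
          by (simp add: convergent_LIMSEQ_iff)
        then show ?case
          by (intro tendsto_ennrealI tendsto_min tendsto_const)
      qed
      show "(\<integral>\<^sup>+ z. ennreal c \<partial>N) < \<infinity>"
        by (simp add: emeasure_space_1)
    qed (simp_all add: ennreal_leI)
    have "(\<integral>\<^sup>+ z. ennreal (min (lim (\<lambda>n. q (Suc n) z)) c) \<partial>N) \<le> ?I"
    proof (rule nn_integral_mono_AE)
      show "AE z in N. ennreal (min (lim (\<lambda>n. q (Suc n) z)) c) \<le> liminf (\<lambda>n. ennreal (q n z))"
        using conv
      proof eventually_elim
        case (elim z)
        then have *: "(\<lambda>n. q n z) \<longlonglongrightarrow> lim (\<lambda>n. q n z)"
          by (simp add: convergent_LIMSEQ_iff)
        then have "lim (\<lambda>n. q (Suc n) z) = lim (\<lambda>n. q n z)"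
          by (intro limI LIMSEQ_Suc)
        moreover have "liminf (\<lambda>n. ennreal (q n z)) = ennreal (lim (\<lambda>n. q n z))"
          using * by (intro lim_imp_Liminf tendsto_ennrealI) auto
        ultimately show ?case
          by (simp add: ennreal_leI)
      qed
    qed
    moreover have "1 \<le> (\<integral>\<^sup>+ z. ennreal (min (q (Suc n) z) c) \<partial>N) + tail c" for n
    proof -
      have "1 = (\<integral>\<^sup>+ z. ennreal (q (Suc n) z) \<partial>N)"
        by (simp add: one)
      also have "\<dots> \<le> (\<integral>\<^sup>+ z. ennreal (min (q (Suc n) z) c) +
          ennreal \<bar>q (Suc n) z\<bar> * indicator {z. \<bar>q (Suc n) z\<bar> > c} z \<partial>N)"
        using nonneg by (intro nn_integral_mono) (auto simp: indicator_def min_def ennreal_leI)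
      also have "\<dots> = (\<integral>\<^sup>+ z. ennreal (min (q (Suc n) z) c) \<partial>N) +
          (\<integral>\<^sup>+ z. ennreal \<bar>q (Suc n) z\<bar> * indicator {z. \<bar>q (Suc n) z\<bar> > c} z \<partial>N)"
        by (rule nn_integral_add) auto
      also have "\<dots> \<le> (\<integral>\<^sup>+ z. ennreal (min (q (Suc n) z) c) \<partial>N) + tail c"
        unfolding tail_def by (intro add_mono order_refl SUP_upper2[of "Suc n"]) auto
      finally show ?thesis .
    qed
    then have "1 \<le> (\<integral>\<^sup>+ z. ennreal (min (lim (\<lambda>n. q (Suc n) z)) c) \<partial>N) + tail c"
      by (intro LIMSEQ_le_const[OF tendsto_add[OF lim tendsto_const]]) auto
    ultimately show ?thesis
      by (meson add_mono order_refl order_trans)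
  qed
  have "((\<lambda>c. ?I + tail c) \<longlongrightarrow> ?I + 0) at_top"
    using tail by (intro tendsto_add tendsto_const)
  then show ?thesis
    using bound by (intro tendsto_lowerbound[of "\<lambda>c. ?I + tail c" _ at_top])
      (auto simp: eventually_at_top_dense intro!: exI[of _ 0])
qed

section \<open>The law of the shifted noise\<close>

lemma emeasure_distr_eq_nn_integral:
  assumes [measurable]: "u \<in> M \<rightarrow>\<^sub>M N" "A \<in> sets N"
  shows "emeasure (distr M N u) A = (\<integral>\<^sup>+ \<omega>. indicator A (u \<omega>) \<partial>M)"
proof -
  have "emeasure (distr M N u) A = (\<integral>\<^sup>+ z. indicator A z \<partial>distr M N u)"
    by simp
  also have "\<dots> = (\<integral>\<^sup>+ \<omega>. indicator A (u \<omega>) \<partial>M)"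
    by (rule nn_integral_distr) auto
  finally show ?thesis .
qed

text \<open>Translation invariance of Lebesgue measure moves the shift from the argument of
  \<open>g\<close> to the density \<open>r\<close>. Since \<open>r\<close> is positive almost
  everywhere, it can then be factored out, which leaves the quotient of densities.\<close>

lemma (in prob_space) nn_integral_shift_density:
  fixes Z :: "'a \<Rightarrow> real" and r :: "real \<Rightarrow> real"
  assumes Z: "distributed M lborel Z (\<lambda>t. ennreal (r t))"
    and [measurable]: "r \<in> borel_measurable borel" and r: "\<And>t. 0 \<le> r t" "AE t in lborel. 0 < r t"
    and [measurable]: "g \<in> borel_measurable borel"
  shows "(\<integral>\<^sup>+ \<omega>. g (Z \<omega> + c) \<partial>M) = (\<integral>\<^sup>+ \<omega>. ennreal (r (Z \<omega> - c) / r (Z \<omega>)) * g (Z \<omega>) \<partial>M)"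
proof -
  have "(\<integral>\<^sup>+ \<omega>. g (Z \<omega> + c) \<partial>M) = (\<integral>\<^sup>+ t. ennreal (r t) * g (t + c) \<partial>lborel)"
    by (rule distributed_nn_integral[OF Z, symmetric]) simp
  also have "\<dots> = (\<integral>\<^sup>+ t. ennreal (r (t - c)) * g t \<partial>lborel)"
    by (subst (2) nn_integral_real_affine[where c = 1 and t = c]) (simp_all add: add.commute)
  also have "\<dots> = (\<integral>\<^sup>+ t. ennreal (r t) * (ennreal (r (t - c) / r t) * g t) \<partial>lborel)"
  proof (intro nn_integral_cong_AE eventually_mono[OF r(2)])
    fix t assume "0 < r t"
    then have "ennreal (r t) * ennreal (r (t - c) / r t) = ennreal (r (t - c))"
      using r(1) by (simp flip: ennreal_mult)
    then show "ennreal (r (t - c)) * g t = ennreal (r t) * (ennreal (r (t - c) / r t) * g t)"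
      by (simp flip: mult.assoc)
  qed
  also have "\<dots> = (\<integral>\<^sup>+ \<omega>. ennreal (r (Z \<omega> - c) / r (Z \<omega>)) * g (Z \<omega>) \<partial>M)"
    by (rule distributed_nn_integral[OF Z]) simp
  finally show ?thesis .
qed

text \<open>The law \<open>P\<close> of the translated vector is compared with the law
  \<open>Q\<close> of the original vector under the reweighted measure. On boxes independence
  factors both into one-dimensional integrals, which agree by the previous lemma; boxes determine
  finite measures on the product, and this extends the identity to every
  \<open>\<phi>\<close>.\<close>

lemma (in prob_space) nn_integral_shift_density_PiM:
  fixes Z :: "'i \<Rightarrow> 'a \<Rightarrow> real" and r :: "'i \<Rightarrow> real \<Rightarrow> real"
  assumes I: "finite I" and indep: "indep_vars (\<lambda>_. borel) Z I"
    and Z: "\<And>i. i \<in> I \<Longrightarrow> distributed M lborel (Z i) (\<lambda>t. ennreal (r i t))"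
    and r_meas: "\<And>i. i \<in> I \<Longrightarrow> r i \<in> borel_measurable borel"
    and r: "\<And>i t. 0 \<le> r i t" "\<And>i. i \<in> I \<Longrightarrow> AE t in lborel. 0 < r i t"
    and [measurable]: "\<phi> \<in> borel_measurable (PiM I (\<lambda>_. borel))"
  shows "(\<integral>\<^sup>+ \<omega>. \<phi> (\<lambda>i\<in>I. Z i \<omega> + c i) \<partial>M) =
    (\<integral>\<^sup>+ \<omega>. ennreal (\<Prod>i\<in>I. r i (Z i \<omega> - c i) / r i (Z i \<omega>)) * \<phi> (\<lambda>i\<in>I. Z i \<omega>) \<partial>M)"
proof -
  have [measurable]: "Z i \<in> borel_measurable M" if "i \<in> I" for i
    using indep that by (auto simp: indep_vars_def)
  define q where "q i t = r i (t - c i) / r i t" for i t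
  have [measurable]: "q i \<in> borel_measurable borel" if "i \<in> I" for i
    using r_meas[OF that] unfolding q_def by measurable
  define w where "w \<omega> = (\<Prod>i\<in>I. ennreal (q i (Z i \<omega>)))" for \<omega>
  have w: "w \<omega> = ennreal (\<Prod>i\<in>I. r i (Z i \<omega> - c i) / r i (Z i \<omega>))" for \<omega>
    unfolding w_def q_def using r(1) by (intro prod_ennreal) simp
  have [measurable]: "w \<in> borel_measurable M"
    unfolding w_def by measurable
  let ?B = "PiM I (\<lambda>_. borel :: real measure)"
  have Zm [measurable]: "(\<lambda>\<omega>. \<lambda>i\<in>I. Z i \<omega>) \<in> M \<rightarrow>\<^sub>M ?B" "(\<lambda>\<omega>. \<lambda>i\<in>I. Z i \<omega> + c i) \<in> M \<rightarrow>\<^sub>M ?B"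
    by measurable
  define P where "P = distr M ?B (\<lambda>\<omega>. \<lambda>i\<in>I. Z i \<omega> + c i)"
  define Q where "Q = distr (density M w) ?B (\<lambda>\<omega>. \<lambda>i\<in>I. Z i \<omega>)"
  have "P = Q"
  proof (rule measure_eqI_PiM_finite[OF I])
    show "sets P = sets ?B" "sets Q = sets ?B"
      by (simp_all add: P_def Q_def)
    show "range (\<lambda>_::nat. space ?B) \<subseteq> prod_algebra I (\<lambda>_. borel)"
      unfolding space_PiM using prod_algebraI_finite[OF I, of "\<lambda>_. UNIV" "\<lambda>_. borel"] by simp
    show "P (space ?B) \<noteq> \<infinity>"
      using prob_space.emeasure_space_1[OF prob_space_distr[OF Zm(2)]] by (simp add: P_def)
    fix A :: "'i \<Rightarrow> real set" assume A: "\<And>i. i \<in> I \<Longrightarrow> A i \<in> sets borel"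
    then have A' [measurable]: "Pi\<^sub>E I A \<in> sets ?B"
      using I by (intro sets_PiM_I_finite) auto
    have ind: "indicator (Pi\<^sub>E I A) (\<lambda>i\<in>I. u i) = (\<Prod>i\<in>I. indicator (A i) (u i) :: ennreal)" for u
      using I by (auto simp: indicator_def PiE_def Pi_def)
    have "P (Pi\<^sub>E I A) = (\<integral>\<^sup>+ \<omega>. indicator (Pi\<^sub>E I A) (\<lambda>i\<in>I. Z i \<omega> + c i) \<partial>M)"
      unfolding P_def by (rule emeasure_distr_eq_nn_integral) auto
    also have "\<dots> = (\<integral>\<^sup>+ \<omega>. (\<Prod>i\<in>I. indicator (A i) (Z i \<omega> + c i)) \<partial>M)"
      by (simp add: ind)
    also have "\<dots> = (\<Prod>i\<in>I. \<integral>\<^sup>+ \<omega>. indicator (A i) (Z i \<omega> + c i) \<partial>M)"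
      using A by (intro indep_vars_nn_integral[OF I] indep_vars_compose2[OF indep]) auto
    also have "\<dots> = (\<Prod>i\<in>I. \<integral>\<^sup>+ \<omega>. ennreal (q i (Z i \<omega>)) * indicator (A i) (Z i \<omega>) \<partial>M)"
      unfolding q_def using A r_meas r Z
      by (intro prod.cong refl nn_integral_shift_density) auto
    also have "\<dots> = (\<integral>\<^sup>+ \<omega>. (\<Prod>i\<in>I. ennreal (q i (Z i \<omega>)) * indicator (A i) (Z i \<omega>)) \<partial>M)"
      using A by (intro indep_vars_nn_integral[OF I, symmetric] indep_vars_compose2[OF indep]) auto
    also have "\<dots> = (\<integral>\<^sup>+ \<omega>. w \<omega> * indicator (Pi\<^sub>E I A) (\<lambda>i\<in>I. Z i \<omega>) \<partial>M)"
      by (simp add: w_def ind prod.distrib)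
    also have "\<dots> = Q (Pi\<^sub>E I A)"
      unfolding Q_def by (subst emeasure_distr_eq_nn_integral) (simp_all add: nn_integral_density)
    finally show "P (Pi\<^sub>E I A) = Q (Pi\<^sub>E I A)" .
  qed (auto simp: space_PiM)
  have "(\<integral>\<^sup>+ \<omega>. \<phi> (\<lambda>i\<in>I. Z i \<omega> + c i) \<partial>M) = integral\<^sup>N P \<phi>"
    by (simp add: P_def nn_integral_distr)
  also have "\<dots> = (\<integral>\<^sup>+ \<omega>. w \<omega> * \<phi> (\<lambda>i\<in>I. Z i \<omega>) \<partial>M)"
    unfolding \<open>P = Q\<close> by (simp add: Q_def nn_integral_distr nn_integral_density)
  finally show ?thesis
    by (simp add: w)
qed

section \<open>Basis expansions and partial products\<close>

lemma coord_eqI: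
  assumes "schauder_basis f" "(\<lambda>i. c i *\<^sub>R f i) sums y"
  shows "coord f y = c"
  unfolding coord_def
  using assms theI'[of "\<lambda>c. (\<lambda>i. c i *\<^sub>R f i) sums y"] unfolding schauder_basis_def by blast

lemma sums_coord:
  assumes "schauder_basis f"
  shows "(\<lambda>i. coord f y i *\<^sub>R f i) sums y"
  unfolding coord_def
  using assms theI'[of "\<lambda>c. (\<lambda>i. c i *\<^sub>R f i) sums y"] unfolding schauder_basis_def by blast

lemma borel_measurable_scaleR_vector:
  fixes v :: "'g::locally_convex_space"
  shows "(\<lambda>t. t *\<^sub>R v) \<in> borel_measurable borel"
proof (rule borel_measurable_continuous_onI)
  show "continuous_on UNIV (\<lambda>t. t *\<^sub>R v)"
    unfolding continuous_on_def
  proof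
    fix t :: real
    have "((\<lambda>s. (s, v)) \<longlongrightarrow> (t, v)) (at t)"
      by (intro tendsto_intros)
    then have "filterlim (\<lambda>s. (s, v)) (nhds t \<times>\<^sub>F nhds v) (at t)"
      by (simp add: nhds_prod)
    from filterlim_compose[OF tendsto_scaleR_Pair this]
    show "((\<lambda>t. t *\<^sub>R v) \<longlongrightarrow> t *\<^sub>R v) (at t within UNIV)"
      by simp
  qed
qed

lemma borel_measurable_sum_scaleR:
  fixes f :: "nat \<Rightarrow> 'g::locally_convex_space"
  assumes "countable_network (\<N> :: 'g set set)"
    and "\<And>i. i < n \<Longrightarrow> u i \<in> borel_measurable M"
  shows "(\<lambda>w. \<Sum>i<n. u i w *\<^sub>R f i) \<in> borel_measurable M"
  using assms(2)
proof (induction n)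
  case (Suc n)
  then have "(\<lambda>w. u n w *\<^sub>R f n) \<in> borel_measurable M"
    using measurable_compose[OF _ borel_measurable_scaleR_vector] by blast
  with Suc show ?case
    by (auto intro!: borel_measurable_add_network[OF assms(1)])
qed simp

text \<open>The product of quotients equals the quotient of products even if a denominator vanishes,
  because both sides are then zero by convention.\<close>

lemma likelihood_eq_liminf:
  "likelihood f \<rho> h y = liminf (\<lambda>n. ennreal (shift_density f \<rho> h n y))"
  by (simp add: likelihood_def infprod_def shift_density_def prod_dividef)

text \<open>Lower semicontinuity of the indicator of an open set, with weights \<open>q\<close>: if
  the limit lies in \<open>U\<close>, then so do almost all terms. This is the pointwise bound to
  which Fatou's lemma is applied.\<close>

lemma liminf_indicator_open_ge:
  assumes "open U" "s \<longlonglongrightarrow> (y :: 'g::topological_space)"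
  shows "indicator U y * liminf q \<le> liminf (\<lambda>n. indicator U (s n) * q n :: ennreal)"
proof (cases "y \<in> U")
  case True
  then have "eventually (\<lambda>n. s n \<in> U) sequentially"
    using assms topological_tendstoD by blast
  then have "liminf q = liminf (\<lambda>n. indicator U (s n) * q n)"
    by (intro Liminf_eq) (auto elim: eventually_mono)
  with True show ?thesis
    by simp
qed simp

lemma (in prob_space) distr_shift_eq_density_likelihood:
  fixes f :: "nat \<Rightarrow> 'g::{locally_convex_space, t2_space}" and Z :: "nat \<Rightarrow> 'a \<Rightarrow> real"
  assumes net: "countable_network (\<N> :: 'g set set)"
    and basis: "schauder_basis f"
    and coord [measurable]: "\<And>i. (\<lambda>y. coord f y i) \<in> borel_measurable borel"
    and \<epsilon> [measurable]: "\<epsilon> \<in> borel_measurable M"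
    and indep: "indep_vars (\<lambda>_. borel) Z UNIV"
    and \<rho>_meas [measurable]: "\<And>i. \<rho> i \<in> borel_measurable borel"
    and \<rho>: "\<And>i t. 0 \<le> \<rho> i t" "\<And>i. AE t in lborel. 0 < \<rho> i t"
    and Z: "\<And>i. distributed M lborel (Z i) (\<lambda>t. ennreal (\<rho> i t))"
    and sums: "AE \<omega> in M. (\<lambda>i. Z i \<omega> *\<^sub>R f i) sums \<epsilon> \<omega>"
    and ui: "uniformly_integrable (distr M borel \<epsilon>) {1..} (shift_density f \<rho> h)"
    and conv: "AE y in distr M borel \<epsilon>. convergent (\<lambda>n. shift_density f \<rho> h n y)"
  shows "distr M borel (\<lambda>\<omega>. h + \<epsilon> \<omega>) = density (distr M borel \<epsilon>) (likelihood f \<rho> h)"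
proof -
  have Z_meas [measurable]: "Z i \<in> borel_measurable M" for i
    using indep by (auto simp: indep_vars_def)
  have shift_meas [measurable]: "shift_density f \<rho> h n \<in> borel_measurable borel" for n
    unfolding shift_density_def by measurable
  have lik_meas [measurable]: "likelihood f \<rho> h \<in> borel_measurable borel"
    unfolding likelihood_eq_liminf[abs_def] by measurable
  have \<epsilon>h [measurable]: "(\<lambda>\<omega>. h + \<epsilon> \<omega>) \<in> borel_measurable M"
    by (rule borel_measurable_add_network[OF net]) auto
  define S where "S n \<omega> = (\<Sum>i<n. Z i \<omega> *\<^sub>R f i)" for n \<omega>
  define S' where "S' n \<omega> = (\<Sum>i<n. (Z i \<omega> + coord f h i) *\<^sub>R f i)" for n \<omega>
  have [measurable]: "S n \<in> borel_measurable M" "S' n \<in> borel_measurable M" for n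
    unfolding S_def[abs_def] S'_def[abs_def] by (intro borel_measurable_sum_scaleR[OF net]; simp)+
  define q where "q n \<omega> = shift_density f \<rho> h n (\<epsilon> \<omega>)" for n \<omega>
  have q_nonneg: "0 \<le> shift_density f \<rho> h n y" for n y
    using \<rho>(1) by (auto simp: shift_density_def intro!: divide_nonneg_nonneg prod_nonneg)
  have [measurable]: "q n \<in> borel_measurable M" for n
    unfolding q_def by measurable
  have S_lim: "AE \<omega> in M. (\<lambda>n. S n \<omega>) \<longlonglongrightarrow> \<epsilon> \<omega>"
    using sums by eventually_elim (simp add: S_def sums_def)
  have S'_lim: "AE \<omega> in M. (\<lambda>n. S' n \<omega>) \<longlonglongrightarrow> h + \<epsilon> \<omega>"
    using S_lim
  proof eventually_elim
    case (elim \<omega>)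
    have "(\<lambda>n. S n \<omega> + (\<Sum>i<n. coord f h i *\<^sub>R f i)) \<longlonglongrightarrow> \<epsilon> \<omega> + h"
      using sums_coord[OF basis, of h] elim unfolding sums_def by (intro tendsto_add)
    then show ?case
      by (simp add: S_def S'_def scaleR_add_left sum.distrib add.commute)
  qed
  \<comment> \<open>The law of \<open>S' n\<close> is the law of \<open>S n\<close> reweighted by
    \<open>q n\<close>. Almost surely the coordinates of \<open>\<epsilon> \<omega>\<close> are the
    numbers \<open>Z i \<omega>\<close>, by uniqueness of the expansion, so \<open>q n\<close> is a
    function of the first \<open>n\<close> of them.\<close>
  have shift: "(\<integral>\<^sup>+ \<omega>. indicator B (S' n \<omega>) \<partial>M) = (\<integral>\<^sup>+ \<omega>. indicator B (S n \<omega>) * ennreal (q n \<omega>) \<partial>M)"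
    if [measurable]: "B \<in> sets borel" for B n
  proof -
    define \<phi> where "\<phi> t = (indicator B (\<Sum>i<n. t i *\<^sub>R f i) :: ennreal)" for t :: "nat \<Rightarrow> real"
    have [measurable]: "(\<lambda>t. \<Sum>i<n. t i *\<^sub>R f i) \<in> borel_measurable (PiM {..<n} (\<lambda>_. borel))"
      by (intro borel_measurable_sum_scaleR[OF net]) simp
    have \<phi>: "\<phi> \<in> borel_measurable (PiM {..<n} (\<lambda>_. borel))"
      unfolding \<phi>_def by measurable
    have ind: "indep_vars (\<lambda>_. borel) Z {..<n}"
      using indep by (rule indep_vars_subset) auto
    have "(\<integral>\<^sup>+ \<omega>. indicator B (S' n \<omega>) \<partial>M) = (\<integral>\<^sup>+ \<omega>. \<phi> (\<lambda>i\<in>{..<n}. Z i \<omega> + coord f h i) \<partial>M)"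
      by (simp add: \<phi>_def S'_def)
    also have "\<dots> = (\<integral>\<^sup>+ \<omega>. ennreal (\<Prod>i<n. \<rho> i (Z i \<omega> - coord f h i) / \<rho> i (Z i \<omega>)) *
        \<phi> (\<lambda>i\<in>{..<n}. Z i \<omega>) \<partial>M)"
      by (rule nn_integral_shift_density_PiM[OF _ ind Z \<rho>_meas \<rho> \<phi>]) auto
    also have "\<dots> = (\<integral>\<^sup>+ \<omega>. indicator B (S n \<omega>) * ennreal (q n \<omega>) \<partial>M)"
    proof (intro nn_integral_cong_AE eventually_mono[OF sums])
      fix \<omega> assume "(\<lambda>i. Z i \<omega> *\<^sub>R f i) sums \<epsilon> \<omega>"
      then have "coord f (\<epsilon> \<omega>) = (\<lambda>i. Z i \<omega>)"
        by (rule coord_eqI[OF basis])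
      then show "ennreal (\<Prod>i<n. \<rho> i (Z i \<omega> - coord f h i) / \<rho> i (Z i \<omega>)) *
          \<phi> (\<lambda>i\<in>{..<n}. Z i \<omega>) = indicator B (S n \<omega>) * ennreal (q n \<omega>)"
        by (simp add: \<phi>_def S_def q_def shift_density_def prod_dividef mult.commute)
    qed
    finally show ?thesis .
  qed
  define \<nu> where "\<nu> = density (distr M borel \<epsilon>) (likelihood f \<rho> h)"
  have \<nu>: "emeasure \<nu> B = (\<integral>\<^sup>+ \<omega>. indicator B (\<epsilon> \<omega>) * liminf (\<lambda>n. ennreal (q n \<omega>)) \<partial>M)"
    if [measurable]: "B \<in> sets borel" for B
    unfolding \<nu>_def
    by (simp add: emeasure_density nn_integral_distr likelihood_eq_liminf q_def mult.commute)
  have distr: "emeasure (distr M borel (\<lambda>\<omega>. h + \<epsilon> \<omega>)) B = (\<integral>\<^sup>+ \<omega>. indicator B (h + \<epsilon> \<omega>) \<partial>M)"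
    if [measurable]: "B \<in> sets borel" for B
    by (rule emeasure_distr_eq_nn_integral) auto
  have \<mu>_le: "emeasure (distr M borel (\<lambda>\<omega>. h + \<epsilon> \<omega>)) U \<le>
      liminf (\<lambda>n. \<integral>\<^sup>+ \<omega>. indicator U (S' n \<omega>) \<partial>M)" if U: "open U" for U
  proof -
    have [measurable]: "U \<in> sets borel"
      using U by simp
    have "emeasure (distr M borel (\<lambda>\<omega>. h + \<epsilon> \<omega>)) U \<le>
        (\<integral>\<^sup>+ \<omega>. liminf (\<lambda>n. indicator U (S' n \<omega>)) \<partial>M)"
      unfolding distr[OF \<open>U \<in> sets borel\<close>]
    proof (intro nn_integral_mono_AE eventually_mono[OF S'_lim])
      fix \<omega> assume "(\<lambda>n. S' n \<omega>) \<longlonglongrightarrow> h + \<epsilon> \<omega>"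
      from liminf_indicator_open_ge[OF U this, of "\<lambda>_. 1"]
      show "indicator U (h + \<epsilon> \<omega>) \<le> liminf (\<lambda>n. indicator U (S' n \<omega>) :: ennreal)"
        by (simp add: Liminf_const)
    qed
    also have "\<dots> \<le> liminf (\<lambda>n. \<integral>\<^sup>+ \<omega>. indicator U (S' n \<omega>) \<partial>M)"
      by (rule nn_integral_liminf) simp
    finally show ?thesis .
  qed
  \<comment> \<open>Fatou's lemma is applied to the reweighted laws of \<open>S n\<close>;
    \<open>shift\<close> turns these into the laws of \<open>S' n\<close>, so the bound is the same
    as in \<open>\<mu>_le\<close>.\<close>
  have \<nu>_le: "emeasure \<nu> U \<le> liminf (\<lambda>n. \<integral>\<^sup>+ \<omega>. indicator U (S' n \<omega>) \<partial>M)" if U: "open U" for U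
  proof -
    have [measurable]: "U \<in> sets borel"
      using U by simp
    have "emeasure \<nu> U \<le> (\<integral>\<^sup>+ \<omega>. liminf (\<lambda>n. indicator U (S n \<omega>) * ennreal (q n \<omega>)) \<partial>M)"
      unfolding \<nu>[OF \<open>U \<in> sets borel\<close>]
      by (intro nn_integral_mono_AE eventually_mono[OF S_lim] liminf_indicator_open_ge[OF U])
    also have "\<dots> \<le> liminf (\<lambda>n. \<integral>\<^sup>+ \<omega>. indicator U (S n \<omega>) * ennreal (q n \<omega>) \<partial>M)"
      by (rule nn_integral_liminf) simp
    finally show ?thesis
      by (simp add: shift)
  qed
  have S'_disj: "(\<integral>\<^sup>+ \<omega>. indicator U (S' n \<omega>) \<partial>M) + (\<integral>\<^sup>+ \<omega>. indicator V (S' n \<omega>) \<partial>M) \<le> 1"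
    if "open U" "open V" "U \<inter> V = {}" for U V n
  proof -
    have [measurable]: "U \<in> sets borel" "V \<in> sets borel"
      using that by auto
    have "(\<integral>\<^sup>+ \<omega>. indicator U (S' n \<omega>) \<partial>M) + (\<integral>\<^sup>+ \<omega>. indicator V (S' n \<omega>) \<partial>M) =
        (\<integral>\<^sup>+ \<omega>. indicator U (S' n \<omega>) + indicator V (S' n \<omega>) \<partial>M)"
      by (rule nn_integral_add[symmetric]) auto
    also have "\<dots> \<le> (\<integral>\<^sup>+ \<omega>. 1 \<partial>M)"
      using that by (intro nn_integral_mono) (auto simp: indicator_def)
    finally show ?thesis
      by (simp add: emeasure_space_1)
  qed
  have "distr M borel (\<lambda>\<omega>. h + \<epsilon> \<omega>) = \<nu>"
  proof (rule prob_eqI_disjoint_open[OF net])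
    show "prob_space (distr M borel (\<lambda>\<omega>. h + \<epsilon> \<omega>))"
      by (rule prob_space_distr) simp
    \<comment> \<open>Taking \<open>B = UNIV\<close> in \<open>shift\<close> shows that every
      \<open>q n\<close> integrates to one. Uniform integrability then gives \<open>\<nu>\<close>
      mass at least one, and \<open>\<nu>_le\<close> for the whole space gives at most one.\<close>
    show "prob_space \<nu>"
    proof
      have "(\<integral>\<^sup>+ y. ennreal (shift_density f \<rho> h n y) \<partial>distr M borel \<epsilon>) = 1" for n
        using shift[of UNIV n] by (simp add: nn_integral_distr q_def emeasure_space_1)
      then have "1 \<le> (\<integral>\<^sup>+ y. liminf (\<lambda>n. ennreal (shift_density f \<rho> h n y)) \<partial>distr M borel \<epsilon>)"
        using conv q_nonneg
        by (intro uniformly_integrable_nn_integral_liminf_ge_1[OF prob_space_distr ui]) auto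
      then have "1 \<le> emeasure \<nu> UNIV"
        by (simp add: \<nu> nn_integral_distr q_def)
      moreover have "emeasure \<nu> UNIV \<le> liminf (\<lambda>n. \<integral>\<^sup>+ \<omega>. indicator UNIV (S' n \<omega>) \<partial>M)"
        by (rule \<nu>_le) simp
      ultimately show "emeasure \<nu> (space \<nu>) = 1"
        by (simp add: \<nu>_def emeasure_space_1 Liminf_const)
    qed
    \<comment> \<open>The laws of \<open>S' n\<close> give \<open>U\<close> and \<open>V\<close>
      together mass at most one, and superadditivity of the lower limit carries this over to the two
      limit measures.\<close>
    show "emeasure (distr M borel (\<lambda>\<omega>. h + \<epsilon> \<omega>)) U + emeasure \<nu> V \<le> 1"
      if "open U" "open V" "U \<inter> V = {}" for U V
      using add_mono[OF \<mu>_le[OF that(1)] \<nu>_le[OF that(2)]] ennreal_liminf_add_le[OF S'_disj[OF that]]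
      by (rule order_trans)
  qed (simp_all add: \<nu>_def)
  then show ?thesis
    by (simp add: \<nu>_def)
qed

section \<open>Posterior distributions\<close>

text \<open>For a fixed Borel set, two solutions are versions of one conditional expectation and so
  agree almost everywhere. A countable generator closed under intersection allows one exceptional
  null set for all of its members, and off this set the two probability measures coincide.\<close>

lemma posterior_solution_essentially_unique:
  fixes X :: "'w \<Rightarrow> 'f::t2_space" and Y :: "'w \<Rightarrow> 'g::topological_space"
  assumes "prob_space M" and Y [measurable]: "Y \<in> borel_measurable M"
    and souslin: "souslin_space TYPE('f)" and \<mu>: "posterior_solution M X Y \<mu>"
  shows "essentially_unique_posterior M X Y \<mu>"
  unfolding essentially_unique_posterior_def
proof (intro conjI allI impI \<mu>)
  fix \<mu>' assume \<mu>': "posterior_solution M X Y \<mu>'"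
  interpret prob_space M by fact
  define N where "N = distr M borel Y"
  interpret N: prob_space N
    unfolding N_def by (rule prob_space_distr) simp
  interpret CN: prob_space "completion N"
    using N.emeasure_space_1 by (intro prob_spaceI) simp
  have space_N [simp]: "space N = UNIV"
    by (simp add: N_def)
  obtain \<N> :: "'f set set" where "countable_network \<N>"
    by (rule souslin_space_countable_network[OF souslin])
  then obtain \<S> :: "'f set set"
    where \<S>: "countable \<S>" "\<And>U. U \<in> \<S> \<Longrightarrow> open U" "point_separating \<S>"
    by (rule countable_network_point_separating) blast
  \<comment> \<open>Finite intersections give stability under intersection and keep the family
    countable; the empty intersection contributes \<open>UNIV\<close>.\<close>
  define \<E> where "\<E> = Inter ` {F. finite F \<and> F \<subseteq> \<S>}"
  have \<E>_countable: "countable \<E>"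
    unfolding \<E>_def by (intro countable_image countable_Collect_finite_subset \<S>(1))
  have \<E>_open: "open A" if "A \<in> \<E>" for A
    using that \<S>(2) by (auto simp: \<E>_def intro!: open_Inter)
  have "\<S> \<subseteq> \<E>"
  proof
    fix U assume "U \<in> \<S>"
    then show "U \<in> \<E>"
      unfolding \<E>_def by (intro image_eqI[of _ _ "{U}"]) auto
  qed
  have \<E>_sigma: "sets borel = sigma_sets UNIV \<E>"
  proof
    show "sets borel \<subseteq> sigma_sets UNIV \<E>"
      using souslin_borel_eq_sigma_sets[OF souslin \<S>(2,3)] sigma_sets_mono'[OF \<open>\<S> \<subseteq> \<E>\<close>]
      by simp
    have "\<E> \<subseteq> sets borel"
      using \<E>_open by auto
    then show "sigma_sets UNIV \<E> \<subseteq> sets borel"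
      using sets.sigma_sets_subset[of \<E> borel] by simp
  qed
  have \<E>_Int: "Int_stable \<E>"
  proof (rule Int_stableI)
    fix A B assume "A \<in> \<E>" "B \<in> \<E>"
    then obtain F G where "A = \<Inter>F" "finite F" "F \<subseteq> \<S>" "B = \<Inter>G" "finite G" "G \<subseteq> \<S>"
      by (auto simp: \<E>_def)
    then show "A \<inter> B \<in> \<E>"
      unfolding \<E>_def by (intro image_eqI[of _ _ "F \<union> G"]) auto
  qed
  have \<E>_UNIV: "UNIV \<in> \<E>"
    unfolding \<E>_def by (intro image_eqI[of _ _ "{}"]) auto
  define C where "C = {y. \<forall>A\<in>\<E>. measure (\<mu>' y) A = measure (\<mu> y) A}"
  have meas: "(\<lambda>y. measure (\<mu> y) A) \<in> borel_measurable (completion N)"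
      "(\<lambda>y. measure (\<mu>' y) A) \<in> borel_measurable (completion N)" if "A \<in> \<E>" for A
    using \<mu> \<mu>' \<E>_open[OF that] by (auto simp: posterior_solution_def N_def)
  have AE_eq: "AE y in completion N. measure (\<mu>' y) A = measure (\<mu> y) A" if A: "A \<in> \<E>" for A
  proof -
    \<comment> \<open>Solutions are measurable only with respect to the completion. Borel
      representatives \<open>u\<close> and \<open>u'\<close> make the set of agreement Borel, so
      that almost sure equality along \<open>Y\<close> transfers to the law of
      \<open>Y\<close>.\<close>
    obtain u where u [measurable]: "u \<in> borel_measurable N" "AE y in N. measure (\<mu> y) A = u y"
      using completion_ex_borel_measurable_real[OF meas(1)[OF A]] by blast
    obtain u' where u' [measurable]: "u' \<in> borel_measurable N" "AE y in N. measure (\<mu>' y) A = u' y"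
      using completion_ex_borel_measurable_real[OF meas(2)[OF A]] by blast
    have [measurable]: "u \<in> borel_measurable borel" "u' \<in> borel_measurable borel"
      using u(1) u'(1) by (simp_all add: N_def)
    have "AE \<omega> in M. measure (\<mu> (Y \<omega>)) A = u (Y \<omega>)" "AE \<omega> in M. measure (\<mu>' (Y \<omega>)) A = u' (Y \<omega>)"
      using u(2) u'(2) unfolding N_def by (auto dest: AE_distrD[OF Y])
    moreover have "AE \<omega> in M. measure (\<mu> (Y \<omega>)) A =
        real_cond_exp M (vimage_algebra (space M) Y borel) (\<lambda>\<omega>. indicator A (X \<omega>)) \<omega>"
      "AE \<omega> in M. measure (\<mu>' (Y \<omega>)) A =
        real_cond_exp M (vimage_algebra (space M) Y borel) (\<lambda>\<omega>. indicator A (X \<omega>)) \<omega>"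
      using \<mu> \<mu>' \<E>_open[OF A] by (auto simp: posterior_solution_def)
    ultimately have "AE \<omega> in M. u (Y \<omega>) = u' (Y \<omega>)"
      by eventually_elim simp
    then have "AE y in N. u y = u' y"
      unfolding N_def by (subst AE_distr_iff) auto
    with u(2) u'(2) have "AE y in N. measure (\<mu>' y) A = measure (\<mu> y) A"
      by eventually_elim simp
    then show ?thesis
      by (rule AE_completion)
  qed
  have C_eq: "C = (\<Inter>A\<in>\<E>. {y \<in> space (completion N). measure (\<mu>' y) A = measure (\<mu> y) A})"
    by (auto simp: C_def)
  have C_sets: "C \<in> sets (completion N)"
    unfolding C_eq
  proof (rule sets.countable_INT'[OF \<E>_countable])
    show "\<E> \<noteq> {}"
      using \<E>_UNIV by auto
    show "(\<lambda>A. {y \<in> space (completion N). measure (\<mu>' y) A = measure (\<mu> y) A}) ` \<E>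
        \<subseteq> sets (completion N)"
    proof (rule image_subsetI)
      fix A assume "A \<in> \<E>"
      note [measurable] = meas[OF this]
      show "{y \<in> space (completion N). measure (\<mu>' y) A = measure (\<mu> y) A} \<in> sets (completion N)"
        by measurable
    qed
  qed
  have "AE y in completion N. y \<in> C"
    using AE_eq unfolding C_def by (simp add: AE_ball_countable[OF \<E>_countable])
  then have "measure (completion N) C = 1"
    using CN.prob_eq_1[OF C_sets] by simp
  moreover have "measure (\<mu>' y) U = measure (\<mu> y) U" if "y \<in> C" and U: "U \<in> sets borel" for y U
  proof -
    have sets: "sets (\<mu> y) = sets borel" "sets (\<mu>' y) = sets borel"
      and prob: "prob_space (\<mu> y)" "prob_space (\<mu>' y)"
      using \<mu> \<mu>' by (auto simp: posterior_solution_def)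
    have fin: "emeasure (\<mu> y) A = ennreal (measure (\<mu> y) A)"
        "emeasure (\<mu>' y) A = ennreal (measure (\<mu>' y) A)" for A
      using prob by (simp_all add: finite_measure.emeasure_eq_measure prob_space_def)
    have "\<mu>' y = \<mu> y"
    proof (rule measure_eqI_generator_eq[of \<E> UNIV _ _ "\<lambda>_. UNIV"])
      show "emeasure (\<mu>' y) A = emeasure (\<mu> y) A" if "A \<in> \<E>" for A
        using that \<open>y \<in> C\<close> by (simp add: fin C_def)
    qed (use \<E>_Int \<E>_sigma \<E>_UNIV sets fin in auto)
    then show ?thesis
      by simp
  qed
  ultimately show "\<exists>C\<in>sets (completion (distr M borel Y)).
      measure (completion (distr M borel Y)) C = 1 \<and>
      (\<forall>y\<in>C. \<forall>U\<in>sets borel. measure (\<mu>' y) U = measure (\<mu> y) U)"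
    using C_sets by (auto simp: N_def)
qed

section \<open>Bayes' formula for a jointly measurable likelihood\<close>

text \<open>Where the normalizing constant is zero or infinite, the prior \<open>\<pi>\<close>
  serves as default, so that a probability measure results for every \<open>y\<close>. The proof
  below shows that this set of \<open>y\<close> is null for the law of \<open>Y\<close>.\<close>

definition bayes_posterior :: "'f measure \<Rightarrow> ('f \<Rightarrow> 'g \<Rightarrow> ennreal) \<Rightarrow> 'g \<Rightarrow> 'f measure" where
  "bayes_posterior \<pi> p y =
     (let c = \<integral>\<^sup>+ x. p x y \<partial>\<pi> in
      if 0 < c \<and> c < \<infinity> then density \<pi> (\<lambda>x. p x y / c) else \<pi>)"

lemma emeasure_bayes_posterior:
  assumes "(\<lambda>x. p x y) \<in> borel_measurable \<pi>" "U \<in> sets \<pi>"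
    and "0 < (\<integral>\<^sup>+ x. p x y \<partial>\<pi>)" "(\<integral>\<^sup>+ x. p x y \<partial>\<pi>) < \<infinity>"
  shows "emeasure (bayes_posterior \<pi> p y) U = (\<integral>\<^sup>+ x\<in>U. p x y \<partial>\<pi>) / (\<integral>\<^sup>+ x. p x y \<partial>\<pi>)"
proof -
  have [measurable]: "(\<lambda>x. p x y) \<in> borel_measurable \<pi>" "U \<in> sets \<pi>"
    by fact+
  have "emeasure (bayes_posterior \<pi> p y) U =
      (\<integral>\<^sup>+ x. p x y / (\<integral>\<^sup>+ x. p x y \<partial>\<pi>) * indicator U x \<partial>\<pi>)"
    using assms(3,4) by (simp add: bayes_posterior_def emeasure_density)
  also have "\<dots> = (\<integral>\<^sup>+ x. p x y * indicator U x / (\<integral>\<^sup>+ x. p x y \<partial>\<pi>) \<partial>\<pi>)"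
    by (simp add: divide_ennreal_def mult_ac)
  also have "\<dots> = (\<integral>\<^sup>+ x\<in>U. p x y \<partial>\<pi>) / (\<integral>\<^sup>+ x. p x y \<partial>\<pi>)"
    by (rule nn_integral_divide) simp
  finally show ?thesis .
qed

lemma sets_bayes_posterior: "sets (bayes_posterior \<pi> p y) = sets \<pi>"
  by (simp add: bayes_posterior_def Let_def)

lemma prob_space_bayes_posterior:
  assumes "prob_space \<pi>" "(\<lambda>x. p x y) \<in> borel_measurable \<pi>"
  shows "prob_space (bayes_posterior \<pi> p y)"
proof (cases "0 < (\<integral>\<^sup>+ x. p x y \<partial>\<pi>) \<and> (\<integral>\<^sup>+ x. p x y \<partial>\<pi>) < \<infinity>")
  case True
  show ?thesis
  proof
    have "(\<integral>\<^sup>+ x\<in>space \<pi>. p x y \<partial>\<pi>) = (\<integral>\<^sup>+ x. p x y \<partial>\<pi>)"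
      by (intro nn_integral_cong) simp
    moreover have "space (bayes_posterior \<pi> p y) = space \<pi>"
      using sets_bayes_posterior by (rule sets_eq_imp_space_eq)
    ultimately show "emeasure (bayes_posterior \<pi> p y) (space (bayes_posterior \<pi> p y)) = 1"
      using True emeasure_bayes_posterior[where p = p and y = y, OF assms(2), of "space \<pi>"]
      by (simp add: zero_less_iff_neq_zero)
  qed
qed (use assms(1) in \<open>auto simp: bayes_posterior_def Let_def\<close>)

text \<open>The hypothesis \<open>joint\<close> says that \<open>(X, Y)\<close> has density
  \<open>p\<close> relative to the product of \<open>\<pi>\<close> and \<open>N\<close>. By Fubini's
  theorem the law of \<open>Y\<close> has density \<open>c\<close>, the normalizing constant,
  relative to \<open>N\<close>; multiplying the posterior by \<open>c\<close> cancels the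
  normalization and gives back the joint law, which characterizes conditional expectation.\<close>

lemma posterior_solution_bayes_posterior:
  fixes M :: "'w measure" and X :: "'w \<Rightarrow> 'f::topological_space"
    and Y :: "'w \<Rightarrow> 'g::topological_space"
  defines "\<pi> \<equiv> distr M borel X"
  assumes "prob_space M" and X [measurable]: "X \<in> borel_measurable M"
    and Y [measurable]: "Y \<in> borel_measurable M"
    and "prob_space N" and sets_N: "sets N = sets borel"
    and p: "case_prod p \<in> borel_measurable (borel \<Otimes>\<^sub>M borel)"
    and joint: "\<And>U B. U \<in> sets borel \<Longrightarrow> B \<in> sets borel \<Longrightarrow>
      emeasure M {\<omega> \<in> space M. X \<omega> \<in> U \<and> Y \<omega> \<in> B} = (\<integral>\<^sup>+ x\<in>U. (\<integral>\<^sup>+ y\<in>B. p x y \<partial>N) \<partial>\<pi>)"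
  shows "posterior_solution M X Y (bayes_posterior \<pi> p)"
proof -
  interpret prob_space M by fact
  interpret N: prob_space N by fact
  interpret \<pi>: prob_space \<pi>
    unfolding \<pi>_def by (rule prob_space_distr) simp
  interpret P: pair_sigma_finite \<pi> N ..
  have sets_\<pi> [measurable_cong]: "sets \<pi> = sets borel"
    by (simp add: \<pi>_def)
  note sets_N [measurable_cong]
  have spaces [simp]: "space \<pi> = UNIV" "space N = UNIV"
    using sets_eq_imp_space_eq[OF sets_\<pi>] sets_eq_imp_space_eq[OF sets_N] by auto
  note [measurable] = p
  have p_x [measurable]: "(\<lambda>x. p x y) \<in> borel_measurable \<pi>" for y
    by measurable
  define c where "c y = (\<integral>\<^sup>+ x. p x y \<partial>\<pi>)" for y
  have [measurable]: "c \<in> borel_measurable borel"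
    unfolding c_def by measurable
  define \<mu> where "\<mu> = bayes_posterior \<pi> p"
  interpret \<mu>: prob_space "\<mu> y" for y
    unfolding \<mu>_def by (rule prob_space_bayes_posterior[where p = p, OF \<pi>.prob_space_axioms p_x])
  have sets_\<mu>: "sets (\<mu> y) = sets borel" for y
    by (simp add: \<mu>_def sets_bayes_posterior sets_\<pi>)
  have \<mu>_eq: "emeasure (\<mu> y) U =
      (if 0 < c y \<and> c y < \<infinity> then (\<integral>\<^sup>+ x\<in>U. p x y \<partial>\<pi>) / c y else emeasure \<pi> U)"
    if "U \<in> sets borel" for y U
    using that emeasure_bayes_posterior[where p = p and y = y, OF p_x, of U]
    by (auto simp: \<mu>_def c_def sets_\<pi>) (auto simp: bayes_posterior_def Let_def)
  have \<mu>_meas [measurable]: "(\<lambda>y. emeasure (\<mu> y) U) \<in> borel_measurable borel"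
    if [measurable]: "U \<in> sets borel" for U
    unfolding \<mu>_eq[OF that] by measurable
  have \<mu>_meas' [measurable]: "(\<lambda>y. measure (\<mu> y) U) \<in> borel_measurable borel"
    if "U \<in> sets borel" for U
    unfolding measure_def using \<mu>_meas[OF that] by measurable
  have joint': "emeasure M {\<omega> \<in> space M. X \<omega> \<in> U \<and> Y \<omega> \<in> B} =
      (\<integral>\<^sup>+ y\<in>B. (\<integral>\<^sup>+ x\<in>U. p x y \<partial>\<pi>) \<partial>N)"
    if [measurable]: "U \<in> sets borel" "B \<in> sets borel" for U B
  proof -
    have "(\<integral>\<^sup>+ x\<in>U. (\<integral>\<^sup>+ y\<in>B. p x y \<partial>N) \<partial>\<pi>) =
        (\<integral>\<^sup>+ x. (\<integral>\<^sup>+ y. p x y * indicator B y * indicator U x \<partial>N) \<partial>\<pi>)"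
      by (intro nn_integral_cong nn_integral_multc[symmetric]) measurable
    also have "\<dots> = (\<integral>\<^sup>+ y. (\<integral>\<^sup>+ x. p x y * indicator B y * indicator U x \<partial>\<pi>) \<partial>N)"
      by (rule P.Fubini'[symmetric]) measurable
    also have "\<dots> = (\<integral>\<^sup>+ y. (\<integral>\<^sup>+ x. p x y * indicator U x * indicator B y \<partial>\<pi>) \<partial>N)"
      by (simp add: mult_ac)
    also have "\<dots> = (\<integral>\<^sup>+ y\<in>B. (\<integral>\<^sup>+ x\<in>U. p x y \<partial>\<pi>) \<partial>N)"
      by (intro nn_integral_cong nn_integral_multc) measurable
    finally show ?thesis
      by (simp add: joint)
  qed
  have distr_Y: "distr M borel Y = density N c"
  proof (rule measure_eqI)
    fix B assume "B \<in> sets (distr M borel Y)"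
    then have [measurable]: "B \<in> sets borel"
      by simp
    have "emeasure (distr M borel Y) B = emeasure M {\<omega> \<in> space M. X \<omega> \<in> UNIV \<and> Y \<omega> \<in> B}"
      by (simp add: emeasure_distr vimage_def Int_def conj_commute)
    also have "\<dots> = emeasure (density N c) B"
      by (subst joint') (simp_all add: emeasure_density c_def)
    finally show "emeasure (distr M borel Y) B = emeasure (density N c) B" .
  qed (simp add: sets_N)
  \<comment> \<open>As a density of the law of \<open>Y\<close>, the function \<open>c\<close> has a
    finite integral.\<close>
  have c_finite: "AE y in N. c y \<noteq> \<infinity>"
  proof (rule nn_integral_PInf_AE)
    have "(\<integral>\<^sup>+ y. c y \<partial>N) = emeasure (distr M borel Y) UNIV"
      unfolding distr_Y by (simp add: emeasure_density)
    also have "\<dots> \<noteq> \<infinity>"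
      using emeasure_space_1 by (simp add: emeasure_distr)
    finally show "(\<integral>\<^sup>+ y. c y \<partial>N) \<noteq> \<infinity>" .
  qed simp
  have bayes: "emeasure M {\<omega> \<in> space M. X \<omega> \<in> U \<and> Y \<omega> \<in> B} =
      (\<integral>\<^sup>+ \<omega>. emeasure (\<mu> (Y \<omega>)) U * indicator B (Y \<omega>) \<partial>M)"
    if [measurable]: "U \<in> sets borel" "B \<in> sets borel" for U B
  proof -
    have "(\<integral>\<^sup>+ \<omega>. emeasure (\<mu> (Y \<omega>)) U * indicator B (Y \<omega>) \<partial>M) =
        (\<integral>\<^sup>+ y. emeasure (\<mu> y) U * indicator B y \<partial>density N c)"
      by (simp add: nn_integral_distr flip: distr_Y)
    also have "\<dots> = (\<integral>\<^sup>+ y. c y * (emeasure (\<mu> y) U * indicator B y) \<partial>N)"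
      by (rule nn_integral_density) measurable
    also have "\<dots> = (\<integral>\<^sup>+ y\<in>B. (\<integral>\<^sup>+ x\<in>U. p x y \<partial>\<pi>) \<partial>N)"
    proof (intro nn_integral_cong_AE eventually_mono[OF c_finite])
      fix y assume "c y \<noteq> \<infinity>"
      \<comment> \<open>If \<open>c y = 0\<close>, the integral of the likelihood over
        \<open>U\<close> vanishes too, so the default value has no effect.\<close>
      have "c y * emeasure (\<mu> y) U = (\<integral>\<^sup>+ x\<in>U. p x y \<partial>\<pi>)"
      proof (cases "c y = 0")
        case True
        have "(\<integral>\<^sup>+ x\<in>U. p x y \<partial>\<pi>) \<le> c y"
          unfolding c_def by (intro nn_integral_mono) (simp add: indicator_def)
        with True show ?thesis
          by simp
      next
        case False
        with \<open>c y \<noteq> \<infinity>\<close> show ?thesis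
          by (simp add: \<mu>_eq less_top zero_less_iff_neq_zero ennreal_times_divide
              mult_divide_eq_ennreal mult.commute[of "c y"])
      qed
      then show "c y * (emeasure (\<mu> y) U * indicator B y) =
          (\<integral>\<^sup>+ x\<in>U. p x y \<partial>\<pi>) * indicator B y"
        by (simp flip: mult.assoc)
    qed
    finally show ?thesis
      by (simp add: joint')
  qed
  define F where "F = vimage_algebra (space M) Y borel"
  have Y_F: "Y \<in> F \<rightarrow>\<^sub>M borel"
    unfolding F_def by (rule measurable_vimage_algebra1) simp
  have F_sets: "sets F = {Y -` B \<inter> space M |B. B \<in> sets borel}"
    unfolding F_def by (rule sets_vimage_algebra2) simp
  interpret F: finite_measure_subalgebra M F
  proof
    have "sets F \<subseteq> sets M"
    proof
      fix A assume "A \<in> sets F"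
      then obtain B where "B \<in> sets borel" "A = Y -` B \<inter> space M"
        unfolding F_sets by blast
      then show "A \<in> sets M"
        using measurable_sets[OF Y] by simp
    qed
    then show "subalgebra M F"
      by (simp add: subalgebra_def F_def)
  qed
  \<comment> \<open>The members of \<open>F\<close> are exactly the preimages of Borel sets under
    \<open>Y\<close>, so \<open>bayes\<close> is the defining identity of the conditional
    expectation. The real integrals are passed through nonnegative ones in order to use it.\<close>
  have "AE \<omega> in M. real_cond_exp M F (\<lambda>\<omega>. indicator U (X \<omega>)) \<omega> = measure (\<mu> (Y \<omega>)) U"
    if U [measurable]: "U \<in> sets borel" for U
  proof (rule F.real_cond_exp_charact)
    show int1: "integrable M (\<lambda>\<omega>. indicator U (X \<omega>) :: real)"
      by (rule integrable_const_bound[of _ 1]) (auto simp: indicator_def)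
    show int2: "integrable M (\<lambda>\<omega>. measure (\<mu> (Y \<omega>)) U)"
      by (rule integrable_const_bound[of _ 1]) (auto intro!: \<mu>.prob_le_1)
    show "(\<lambda>\<omega>. measure (\<mu> (Y \<omega>)) U) \<in> borel_measurable F"
      by (rule measurable_compose[OF Y_F \<mu>_meas'[OF U]])
    fix A assume "A \<in> sets F"
    then obtain B where [measurable]: "B \<in> sets borel" and A: "A = Y -` B \<inter> space M"
      unfolding F_sets by blast
    have "(\<integral>\<omega>\<in>A. indicator U (X \<omega>) \<partial>M) =
        enn2real (\<integral>\<^sup>+ \<omega>. ennreal (indicator B (Y \<omega>) * indicator U (X \<omega>)) \<partial>M)"
      unfolding set_lebesgue_integral_def A
      by (subst integral_eq_nn_integral[symmetric])
        (auto intro!: Bochner_Integration.integral_cong simp: indicator_def)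
    also have "(\<integral>\<^sup>+ \<omega>. ennreal (indicator B (Y \<omega>) * indicator U (X \<omega>)) \<partial>M) =
        (\<integral>\<^sup>+ \<omega>. indicator {\<omega> \<in> space M. X \<omega> \<in> U \<and> Y \<omega> \<in> B} \<omega> \<partial>M)"
      by (intro nn_integral_cong) (auto simp: indicator_def)
    also have "\<dots> = (\<integral>\<^sup>+ \<omega>. emeasure (\<mu> (Y \<omega>)) U * indicator B (Y \<omega>) \<partial>M)"
      by (simp add: bayes)
    also have "\<dots> = (\<integral>\<^sup>+ \<omega>. ennreal (indicator B (Y \<omega>) * measure (\<mu> (Y \<omega>)) U) \<partial>M)"
      by (intro nn_integral_cong) (simp add: \<mu>.emeasure_eq_measure indicator_def)
    also have "enn2real \<dots> = (\<integral>\<omega>\<in>A. measure (\<mu> (Y \<omega>)) U \<partial>M)"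
      unfolding set_lebesgue_integral_def A
      by (subst integral_eq_nn_integral[symmetric])
        (auto intro!: Bochner_Integration.integral_cong simp: indicator_def)
    finally show "(\<integral>\<omega>\<in>A. indicator U (X \<omega>) \<partial>M) = (\<integral>\<omega>\<in>A. measure (\<mu> (Y \<omega>)) U \<partial>M)" .
  qed
  then have "\<forall>U\<in>sets borel. AE \<omega> in M. measure (\<mu> (Y \<omega>)) U =
      real_cond_exp M F (\<lambda>\<omega>. indicator U (X \<omega>)) \<omega>"
    by (simp add: eq_commute)
  moreover have "(\<lambda>y. measure (\<mu> y) U) \<in> borel_measurable (completion (distr M borel Y))"
    if "U \<in> sets borel" for U
    using \<mu>_meas'[OF that] by (intro measurable_completion) simp
  ultimately show ?thesis
    unfolding posterior_solution_def \<mu>_def[symmetric] F_def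
    using sets_\<mu> \<mu>.prob_space_axioms by auto
qed

section \<open>Independent parameter and additive noise\<close>

lemma indep_rv_distr_Pair:
  assumes "prob_space M" and indep: "indep_rv M X Z"
  shows "distr M (borel \<Otimes>\<^sub>M borel) (\<lambda>\<omega>. (X \<omega>, Z \<omega>)) = distr M borel X \<Otimes>\<^sub>M distr M borel Z"
proof -
  interpret prob_space M by fact
  have [measurable]: "X \<in> borel_measurable M" "Z \<in> borel_measurable M"
    using indep by (auto simp: indep_rv_def)
  interpret X: prob_space "distr M borel X"
    by (rule prob_space_distr) simp
  interpret Z: prob_space "distr M borel Z"
    by (rule prob_space_distr) simp
  show ?thesis
  proof (rule pair_measure_eqI[symmetric])
    fix A B assume "A \<in> sets (distr M borel X)" "B \<in> sets (distr M borel Z)"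
    then have [measurable]: "A \<in> sets borel" "B \<in> sets borel"
      by auto
    have "X -` A \<inter> space M \<in> sets (vimage_algebra (space M) X borel)"
      "Z -` B \<inter> space M \<in> sets (vimage_algebra (space M) Z borel)"
      by (auto intro!: in_vimage_algebra)
    then have "prob ((X -` A \<inter> space M) \<inter> (Z -` B \<inter> space M)) =
        prob (X -` A \<inter> space M) * prob (Z -` B \<inter> space M)"
      using indep unfolding indep_rv_def by (blast intro: indep_setD)
    moreover have "(\<lambda>\<omega>. (X \<omega>, Z \<omega>)) -` (A \<times> B) \<inter> space M =
        (X -` A \<inter> space M) \<inter> (Z -` B \<inter> space M)"
      by auto
    ultimately show "emeasure (distr M borel X) A * emeasure (distr M borel Z) B =
        emeasure (distr M (borel \<Otimes>\<^sub>M borel) (\<lambda>\<omega>. (X \<omega>, Z \<omega>))) (A \<times> B)"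
      by (simp add: emeasure_distr emeasure_eq_measure ennreal_mult')
  qed (auto simp: X.sigma_finite_measure_axioms Z.sigma_finite_measure_axioms)
qed

theorem corollary3:
  fixes M :: "'w measure"
    and f :: "nat \<Rightarrow> 'g::{locally_convex_space, t2_space}"
    and X :: "'w \<Rightarrow> 'f::{locally_convex_space, t2_space}"
    and \<epsilon> :: "'w \<Rightarrow> 'g"
    and \<epsilon>c :: "nat \<Rightarrow> 'w \<Rightarrow> real"
    and \<rho> :: "nat \<Rightarrow> real \<Rightarrow> real"
    and L :: "'f \<Rightarrow> 'g"
  defines "Y \<equiv> (\<lambda>\<omega>. L (X \<omega>) + \<epsilon> \<omega>)"
    and "\<mu>\<epsilon> \<equiv> distr M borel \<epsilon>"
    and "\<mu>X \<equiv> distr M borel X"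
  assumes "prob_space M" and "complete_measure M"
    and "souslin_space TYPE('f)" and "souslin_space TYPE('g)"
    and "schauder_basis f"
    and "\<And>i. (\<lambda>y. coord f y i) \<in> borel_measurable borel"
    and "\<epsilon> \<in> borel_measurable M"
    and "prob_space.indep_vars M (\<lambda>_. borel) \<epsilon>c UNIV"
    and "\<And>i. \<rho> i \<in> borel_measurable borel"
    and "\<And>i t. 0 \<le> \<rho> i t"
    and "\<And>i. AE t in lborel. 0 < \<rho> i t"
    and "\<And>i. distributed M lborel (\<epsilon>c i) (\<lambda>t. ennreal (\<rho> i t))"
    and "AE \<omega> in M. (\<lambda>i. \<epsilon>c i \<omega> *\<^sub>R f i) sums \<epsilon> \<omega>"
    and "X \<in> borel_measurable M"
    and "indep_rv M X \<epsilon>"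
    and "continuous_on UNIV L"
    and "\<And>x. uniformly_integrable \<mu>\<epsilon> {1..} (shift_density f \<rho> (L x))"
    and "\<And>x. AE y in \<mu>\<epsilon>. convergent (\<lambda>n. shift_density f \<rho> (L x) n y)"
  shows "\<exists>\<mu> :: 'g \<Rightarrow> 'f measure.
    essentially_unique_posterior M X Y \<mu> \<and>
    (\<forall>y. 0 < (\<integral>\<^sup>+ x. likelihood f \<rho> (L x) y \<partial>\<mu>X) \<and>
         (\<integral>\<^sup>+ x. likelihood f \<rho> (L x) y \<partial>\<mu>X) < \<infinity> \<longrightarrow>
       (\<forall>U\<in>sets borel. emeasure (\<mu> y) U =
          (\<integral>\<^sup>+ x\<in>U. likelihood f \<rho> (L x) y \<partial>\<mu>X) /
          (\<integral>\<^sup>+ x. likelihood f \<rho> (L x) y \<partial>\<mu>X)))"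
proof -
  interpret prob_space M by fact
  note [measurable] = assms(9,10,12,17)
  obtain \<N> :: "'g set set" where net: "countable_network \<N>"
    by (rule souslin_space_countable_network[OF \<open>souslin_space TYPE('g)\<close>])
  have L [measurable]: "L \<in> borel_measurable borel"
    using \<open>continuous_on UNIV L\<close> by (rule borel_measurable_continuous_onI)
  have Y_meas [measurable]: "Y \<in> borel_measurable M"
    unfolding Y_def by (rule borel_measurable_add_network[OF net]) measurable
  have L_plus [measurable]:
    "(\<lambda>z. L (fst z) + snd z) \<in> borel_measurable (borel \<Otimes>\<^sub>M borel)"
    by (rule borel_measurable_add_network[OF net]) measurable
  interpret E: prob_space \<mu>\<epsilon>
    unfolding \<mu>\<epsilon>_def by (rule prob_space_distr) simp
  have p [measurable]:
    "(\<lambda>(x, y). likelihood f \<rho> (L x) y) \<in> borel_measurable (borel \<Otimes>\<^sub>M borel)"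
    unfolding likelihood_eq_liminf shift_density_def by measurable
  have law: "distr M borel (\<lambda>\<omega>. L x + \<epsilon> \<omega>) = density \<mu>\<epsilon> (likelihood f \<rho> (L x))" for x
    unfolding \<mu>\<epsilon>_def
    by (rule distr_shift_eq_density_likelihood[OF net assms(8-16) assms(20,21)[unfolded \<mu>\<epsilon>_def]])
  have joint: "emeasure M {\<omega> \<in> space M. X \<omega> \<in> U \<and> Y \<omega> \<in> B} =
      (\<integral>\<^sup>+ x\<in>U. (\<integral>\<^sup>+ y\<in>B. likelihood f \<rho> (L x) y \<partial>\<mu>\<epsilon>) \<partial>\<mu>X)"
    if [measurable]: "U \<in> sets borel" "B \<in> sets borel" for U B
  proof -
    \<comment> \<open>The event is expressed through the independent pair of \<open>X\<close> and
      \<open>\<epsilon>\<close>, whose joint law is a product measure. The section of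
      \<open>T\<close> at \<open>x\<close> is empty for \<open>x\<close> outside \<open>U\<close>
      and otherwise consists of the noise values that \<open>L x\<close> translates into
      \<open>B\<close>.\<close>
    define T where "T = {z \<in> space (borel \<Otimes>\<^sub>M borel). fst z \<in> U \<and> L (fst z) + snd z \<in> B}"
    have T [measurable]: "T \<in> sets (borel \<Otimes>\<^sub>M borel)"
      unfolding T_def by measurable
    have "{\<omega> \<in> space M. X \<omega> \<in> U \<and> Y \<omega> \<in> B} = (\<lambda>\<omega>. (X \<omega>, \<epsilon> \<omega>)) -` T \<inter> space M"
      by (auto simp: T_def Y_def space_pair_measure)
    then have "emeasure M {\<omega> \<in> space M. X \<omega> \<in> U \<and> Y \<omega> \<in> B} = emeasure (\<mu>X \<Otimes>\<^sub>M \<mu>\<epsilon>) T"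
      unfolding \<mu>X_def \<mu>\<epsilon>_def
      by (simp add: emeasure_distr
          flip: indep_rv_distr_Pair[OF \<open>prob_space M\<close> \<open>indep_rv M X \<epsilon>\<close>])
    also have "\<dots> = (\<integral>\<^sup>+ x. emeasure \<mu>\<epsilon> (Pair x -` T) \<partial>\<mu>X)"
      using T by (intro E.emeasure_pair_measure_alt) (simp add: \<mu>X_def \<mu>\<epsilon>_def cong: sets_pair_measure_cong)
    also have "\<dots> = (\<integral>\<^sup>+ x\<in>U. (\<integral>\<^sup>+ y\<in>B. likelihood f \<rho> (L x) y \<partial>\<mu>\<epsilon>) \<partial>\<mu>X)"
    proof (rule nn_integral_cong)
      fix x
      have shift [measurable]: "(\<lambda>y. L x + y) \<in> borel_measurable borel"
        by (rule borel_measurable_add_network[OF net]) measurable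
      have [measurable]: "likelihood f \<rho> (L x) \<in> borel_measurable borel"
        using measurable_compose[OF measurable_Pair1'[of x borel borel] p] by simp
      \<comment> \<open>The measure of the section is the mass of \<open>B\<close> under the law of
        \<open>L x + \<epsilon>\<close>, where the density from \<open>law\<close> enters.\<close>
      have "emeasure \<mu>\<epsilon> {y. L x + y \<in> B} = emeasure (distr M borel (\<lambda>\<omega>. L x + \<epsilon> \<omega>)) B"
        using measurable_compose[OF assms(10) shift] shift[THEN measurable_sets, of B]
        by (simp add: \<mu>\<epsilon>_def emeasure_distr vimage_def)
      also have "\<dots> = (\<integral>\<^sup>+ y\<in>B. likelihood f \<rho> (L x) y \<partial>\<mu>\<epsilon>)"
        unfolding law by (rule emeasure_density) (simp_all add: \<mu>\<epsilon>_def)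
      finally show "emeasure \<mu>\<epsilon> (Pair x -` T) =
          (\<integral>\<^sup>+ y\<in>B. likelihood f \<rho> (L x) y \<partial>\<mu>\<epsilon>) * indicator U x"
        by (cases "x \<in> U") (simp_all add: T_def space_pair_measure vimage_def)
    qed
    finally show ?thesis .
  qed
  let ?\<mu> = "bayes_posterior \<mu>X (\<lambda>x. likelihood f \<rho> (L x))"
  have "posterior_solution M X Y ?\<mu>"
    unfolding \<mu>X_def using joint E.prob_space_axioms
    by (intro posterior_solution_bayes_posterior[where N = \<mu>\<epsilon>])
      (simp_all add: \<mu>\<epsilon>_def \<mu>X_def \<open>prob_space M\<close>)
  then have "essentially_unique_posterior M X Y ?\<mu>"
    by (rule posterior_solution_essentially_unique[OF \<open>prob_space M\<close> Y_meas
          \<open>souslin_space TYPE('f)\<close>])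
  moreover have "(\<lambda>x. likelihood f \<rho> (L x) y) \<in> borel_measurable \<mu>X" for y
    using measurable_compose[OF measurable_Pair2'[of y borel borel] p] by (simp add: \<mu>X_def)
  then have "emeasure (?\<mu> y) U = (\<integral>\<^sup>+ x\<in>U. likelihood f \<rho> (L x) y \<partial>\<mu>X) /
      (\<integral>\<^sup>+ x. likelihood f \<rho> (L x) y \<partial>\<mu>X)"
    if "U \<in> sets borel" "0 < (\<integral>\<^sup>+ x. likelihood f \<rho> (L x) y \<partial>\<mu>X)"
      "(\<integral>\<^sup>+ x. likelihood f \<rho> (L x) y \<partial>\<mu>X) < \<infinity>" for U y
    using that by (intro emeasure_bayes_posterior) (simp_all add: \<mu>X_def)
  ultimately show ?thesis
    by blast
qed

end
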